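(* There is an algorithm that, given a block size $B \geq 1$ and a fixed-topology binary tree $T$ on $N$ nodes, computes in $O(N)$ time an external-memory layout of $T$ with block size $B$ such that, for every $D$, the number of memory transfers incurred along any root-to-node path of length $D$ in $T$ is $$ O\left( \begin{cases} \dfrac{D}{\lg (1+B)} & \text{when } D = O(\lg N), \\[2ex] \dfrac{\lg N}{\lg \left(1+\frac{B \lg N}{D}\right)} & \text{when } D = \Omega(\lg N) \text{ and } D = O(B \lg N), \\[2ex] \dfrac{D}{B} & \text{when } D = \Omega(B \lg N) \end{cases} \right). $$
   Context: A fixed-topology tree is a rooted tree whose shape (parent/child structure, including which child is left and which is right) is given and may not be changed. An external-memory layout of a tree with $N$ nodes and block size $B$ stores each node exactly once in a linear array; the array is partitioned into consecutive aligned blocks of $B$ positions each. The number of memory transfers incurred along a root-to-node path (visiting the nodes from the root downward in order) is the number of blocks containing nodes of that path. The length $D$ of a root-to-node path is the depth of its final node. $\lg$ denotes the base-2 logarithm. Running time is measured on a RAM.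
   Formalization: Each of the three bounds is read as O(max(1, expression)): every path costs at least one transfer, while e.g. D/lg(1+B) is 0 for D = 0 and tends to 0 for D = 1 and growing B, so the bounds fail without the maximum. *)

theory Defs
  imports Complex_Main "HOL-Library.Tree"
begin

section \<open>Fixed-topology trees, layouts and memory transfers\<close>

text \<open>
  A fixed-topology binary tree is a nonempty \<^typ>\<open>'a tree\<close>; \<^const>\<open>Leaf\<close> stands for an absent child,
  so the nodes are the \<^const>\<open>Node\<close> constructors and their number is \<^term>\<open>size T\<close>.  The labels are
  only names of the nodes: they are pairwise distinct and drawn from \<open>1, ..., size T\<close>, in an arbitrary
  order; the number 0 is kept free for the null pointer.
\<close>

definition fixed_topology_tree :: "nat tree \<Rightarrow> bool" where
  "fixed_topology_tree T \<longleftrightarrow>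
     T \<noteq> Leaf \<and> distinct (inorder T) \<and> set_tree T = {1..size T}"

inductive root_path :: "'a tree \<Rightarrow> 'a list \<Rightarrow> bool" where
  here: "root_path (Node l x r) [x]"
| left: "root_path l p \<Longrightarrow> root_path (Node l x r) (x # p)"
| right: "root_path r p \<Longrightarrow> root_path (Node l x r) (x # p)"

text \<open>The depth of the final node of a path; the root has depth 0.\<close>

definition path_length :: "'a list \<Rightarrow> nat" where
  "path_length p = length p - 1"

text \<open>
  The linear array is a list, in which the node at position \<open>i\<close> lies in block number \<open>i div B\<close>.  There
  are no unused cells before the end of the array.
\<close>

definition is_layout :: "'a tree \<Rightarrow> 'a list \<Rightarrow> bool" where
  "is_layout T L \<longleftrightarrow> distinct L \<and> set L = set_tree T"

definition memory_transfers :: "nat \<Rightarrow> 'a list \<Rightarrow> 'a list \<Rightarrow> nat" where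
  "memory_transfers B L p = card {i div B | i. i < length L \<and> L ! i \<in> set p}"


section \<open>The random-access machine\<close>

text \<open>
  A unit-cost RAM with register names and code labels fixed in the program, and an indirectly
  addressed memory.  Subtraction is truncated at 0, and division by 0 yields 0.  The machine has
  halted when the program counter has left the program.  Since multiplication has unit cost, the
  size of the numbers is controlled separately, by \<open>word_bounded\<close>.
\<close>

datatype instr =
    Const nat nat
  | Move nat nat
  | Add nat nat nat
  | Sub nat nat nat
  | Mul nat nat nat
  | Div nat nat nat
  | Load nat nat
  | Store nat nat
  | Jump nat
  | JumpZero nat nat

record ram =
  pc :: nat
  reg :: "nat \<Rightarrow> nat"
  mem :: "nat \<Rightarrow> nat"

definition set_reg :: "nat \<Rightarrow> nat \<Rightarrow> ram \<Rightarrow> ram" where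
  "set_reg i v s = s\<lparr>pc := Suc (pc s), reg := (reg s)(i := v)\<rparr>"

fun exec_instr :: "instr \<Rightarrow> ram \<Rightarrow> ram" where
  "exec_instr (Const i n) s = set_reg i n s"
| "exec_instr (Move i j) s = set_reg i (reg s j) s"
| "exec_instr (Add i j k) s = set_reg i (reg s j + reg s k) s"
| "exec_instr (Sub i j k) s = set_reg i (reg s j - reg s k) s"
| "exec_instr (Mul i j k) s = set_reg i (reg s j * reg s k) s"
| "exec_instr (Div i j k) s = set_reg i (reg s j div reg s k) s"
| "exec_instr (Load i j) s = set_reg i (mem s (reg s j)) s"
| "exec_instr (Store i j) s = s\<lparr>pc := Suc (pc s), mem := (mem s)(reg s i := reg s j)\<rparr>"
| "exec_instr (Jump l) s = s\<lparr>pc := l\<rparr>"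
| "exec_instr (JumpZero i l) s = s\<lparr>pc := (if reg s i = 0 then l else Suc (pc s))\<rparr>"

definition halted :: "instr list \<Rightarrow> ram \<Rightarrow> bool" where
  "halted P s \<longleftrightarrow> pc s \<ge> length P"

definition step :: "instr list \<Rightarrow> ram \<Rightarrow> ram" where
  "step P s = (if halted P s then s else exec_instr (P ! pc s) s)"

definition run :: "instr list \<Rightarrow> nat \<Rightarrow> ram \<Rightarrow> ram" where
  "run P t = (step P ^^ t)"

definition word_bounded :: "nat \<Rightarrow> ram \<Rightarrow> bool" where
  "word_bounded M s \<longleftrightarrow> (\<forall>i. reg s i \<le> M) \<and> (\<forall>a. mem s a \<le> M)"


section \<open>Input and output conventions\<close>

text \<open>
  The input tree is stored with child pointers: cells \<open>2 * x\<close> and \<open>2 * x + 1\<close> hold the names of the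
  left and right child of node \<open>x\<close>, or 0 if there is no such child.  All other cells are 0.
\<close>

fun root_name :: "nat tree \<Rightarrow> nat" where
  "root_name Leaf = 0"
| "root_name (Node l x r) = x"

fun store_tree :: "nat tree \<Rightarrow> (nat \<Rightarrow> nat) \<Rightarrow> (nat \<Rightarrow> nat)" where
  "store_tree Leaf m = m"
| "store_tree (Node l x r) m =
     store_tree r (store_tree l (m(2 * x := root_name l, 2 * x + 1 := root_name r)))"

text \<open>Registers 0, 1, 2 initially hold the number of nodes, the block size and the root.\<close>

definition initial :: "nat \<Rightarrow> nat tree \<Rightarrow> ram" where
  "initial B T =
     \<lparr>pc = 0, reg = (\<lambda>_. 0)(0 := size T, 1 := B, 2 := root_name T), mem = store_tree T (\<lambda>_. 0)\<rparr>"

text \<open>On halting, the layout is in consecutive memory cells from the address in register 0 on.\<close>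

definition output_array :: "nat \<Rightarrow> ram \<Rightarrow> nat list" where
  "output_array n s = map (\<lambda>i. mem s (reg s 0 + i)) [0..<n]"

text \<open>
  On block size \<open>B\<close> and tree \<open>T\<close>, program \<open>P\<close> halts after at most \<open>t\<close> instructions with output \<open>L\<close>,
  and no number ever held by the machine exceeds \<open>M\<close>.
\<close>

definition computes :: "instr list \<Rightarrow> nat \<Rightarrow> nat tree \<Rightarrow> nat \<Rightarrow> nat \<Rightarrow> nat list \<Rightarrow> bool" where
  "computes P B T t M L \<longleftrightarrow>
     halted P (run P t (initial B T)) \<and>
     L = output_array (size T) (run P t (initial B T)) \<and>
     (\<forall>i\<le>t. word_bounded M (run P i (initial B T)))"

end

theory Submission
  imports Defs "HOL-Library.Multiset"
begin

text \<open>
  The tree is cut into connected groups of at most \<open>4 * B\<close> nodes, which are stored contiguously, so a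
  path pays at most 5 transfers per group that it meets.  In the group with root weight \<open>W\<close>, a node at
  depth \<open>d\<close> of weight \<open>w\<close> is admitted iff \<open>2 ^ d \<le> B\<close> or \<open>w / W \<ge> sqrt (d / B)\<close>.  At most
  \<open>sqrt (B / d)\<close> nodes of depth \<open>d\<close> satisfy the second condition, and these bounds sum to \<open>2 * B\<close>.

  A path that leaves the group at depth \<open>d\<close> has spent at least \<open>log 2 (1 + B)\<close> nodes there, which gives
  the bound for small \<open>D\<close>, and its weight has dropped by the factor \<open>sqrt (d / B)\<close>.  Summing the tangent
  estimate \<open>1 + ln (d / \<theta>) \<le> d / \<theta>\<close> over the \<open>m\<close> groups left by the path gives
  \<open>m * (1 + ln (B / \<theta>)) \<le> 2 * ln N + D / \<theta>\<close> for every \<open>\<theta> > 0\<close>; the other two bounds are the cases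
  \<open>\<theta> = D / (\<beta> * log 2 N)\<close> and \<open>\<theta> = B\<close>.
\<close>

section \<open>Groups of nodes\<close>

text \<open>One layout has to serve every \<open>D\<close>, so admission may depend only on
  \<open>B\<close>, depth and weights; the length enters through \<open>\<theta>\<close>, which the
  analysis picks once the path is known. A threshold on \<open>w / W\<close> at depth
  \<open>d\<close> has two duties that pull apart: the sum of its reciprocals bounds the size of a
  group and must be linear in \<open>B\<close>, while leaving the group early must cost a large drop
  in weight. The powers \<open>(d / B) ^ a\<close> with 0 < a < 1 do both, because the sum of
  \<open>(B / d) ^ a\<close> for \<open>d\<close> up to \<open>B\<close> is still linear in
  \<open>B\<close>, and a drop amounts to a * ln (B / d). The choice a = 1/2 lets the machine decide
  the test exactly on integers, by squaring. Weights alone would let a path leave after one step,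
  into a very light child. The clause \<open>2 ^ d \<le> B\<close> therefore admits the top levels
  unconditionally. They have at most \<open>2 * B - 1\<close> nodes, which together with the
  \<open>2 * B\<close> from the weights explains \<open>4 * B\<close>.\<close>

text \<open>
  In a group of root weight \<open>W\<close>, \<open>q\<close> is \<open>B div 2 ^ d\<close> for a node at depth \<open>d\<close>: this tests
  \<open>2 ^ d \<le> B\<close> without computing numbers that exceed the word size.
\<close>

definition fits :: "nat \<Rightarrow> nat \<Rightarrow> nat \<Rightarrow> nat \<Rightarrow> nat \<Rightarrow> bool" where
  "fits B W d q w \<longleftrightarrow> q > 0 \<or> d * W\<^sup>2 \<le> B * w\<^sup>2"

fun group_nodes :: "nat \<Rightarrow> nat \<Rightarrow> nat \<Rightarrow> nat \<Rightarrow> 'a tree \<Rightarrow> 'a list" where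
  "group_nodes B W d q Leaf = []"
| "group_nodes B W d q (Node l x r) =
     (if fits B W d q (size (Node l x r))
      then x # group_nodes B W (Suc d) (q div 2) l @ group_nodes B W (Suc d) (q div 2) r
      else [])"

text \<open>Right exits precede left ones because the list models a stack with its top at the head:
  the machine scans the left subtree first, so what it pushes last lies on the right.\<close>

fun group_exits :: "nat \<Rightarrow> nat \<Rightarrow> nat \<Rightarrow> nat \<Rightarrow> 'a tree \<Rightarrow> 'a tree list" where
  "group_exits B W d q Leaf = []"
| "group_exits B W d q (Node l x r) =
     (if fits B W d q (size (Node l x r))
      then group_exits B W (Suc d) (q div 2) r @ group_exits B W (Suc d) (q div 2) l
      else [Node l x r])"

abbreviation group :: "nat \<Rightarrow> 'a tree \<Rightarrow> 'a list" where
  "group B t \<equiv> group_nodes B (size t) 0 B t"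

abbreviation exits :: "nat \<Rightarrow> 'a tree \<Rightarrow> 'a tree list" where
  "exits B t \<equiv> group_exits B (size t) 0 B t"

lemma group_partition:
  "mset (inorder t) = mset (group_nodes B W d q t)
     + (\<Sum>u\<leftarrow>group_exits B W d q t. mset (inorder u))"
  by (induction B W d q t rule: group_nodes.induct) auto

lemma group_partition_size:
  "size t = length (group_nodes B W d q t) + (\<Sum>u\<leftarrow>group_exits B W d q t. size u)"
  by (induction B W d q t rule: group_nodes.induct) auto

lemma Leaf_notin_exits: "Leaf \<notin> set (group_exits B W d q t)"
  by (induction B W d q t rule: group_exits.induct) auto

lemma fits_root [simp]: "fits B W 0 q w"
  by (simp add: fits_def)

lemma sum_list_size_exits_less:
  assumes "t \<noteq> Leaf"
  shows "(\<Sum>u\<leftarrow>exits B t. size u) < size t"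
proof -
  have "group B t \<noteq> []"
    using assms by (cases t) auto
  then show ?thesis
    using group_partition_size[of t B "size t" 0 B] by (cases "group B t") auto
qed

text \<open>The argument is the stack of roots of pending groups; putting \<open>exits B t\<close>
  in front yields the order in which the machine emits the groups. Dropping a \<open>Leaf\<close>
  keeps the total size, hence the second measure \<open>length ts\<close>.\<close>

function group_roots :: "nat \<Rightarrow> 'a tree list \<Rightarrow> 'a tree list" where
  "group_roots B [] = []"
| "group_roots B (t # ts) =
     (if t = Leaf then group_roots B ts else t # group_roots B (exits B t @ ts))"
  by pat_completeness auto
termination
  by (relation "measures [\<lambda>(B, ts). \<Sum>u\<leftarrow>ts. size u, \<lambda>(B, ts). length ts]")
     (auto simp: sum_list_size_exits_less)

definition tree_layout :: "nat \<Rightarrow> 'a tree list \<Rightarrow> 'a list" where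
  "tree_layout B ts = concat (map (group B) (group_roots B ts))"

lemma mset_tree_layout:
  "mset (tree_layout B ts) = (\<Sum>t\<leftarrow>ts. mset (inorder t))"
  unfolding tree_layout_def
proof (induction B ts rule: group_roots.induct)
  case (2 B t ts)
  then show ?case
    using group_partition[of t B "size t" 0 B] by simp
qed simp

lemma set_subset_group_roots:
  "Leaf \<notin> set ts \<Longrightarrow> set ts \<subseteq> set (group_roots B ts)"
  by (induction B ts rule: group_roots.induct) (auto simp: Leaf_notin_exits)

lemma Leaf_notin_group_roots: "Leaf \<notin> set (group_roots B ts)"
  by (induction B ts rule: group_roots.induct) auto

text \<open>This lets a path be followed from group to group: where it exits, a listed group starts.
  Expanding a tree puts its exits on the pending list, and by \<open>set_subset_group_roots\<close>
  pending trees are eventually listed.\<close>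

lemma exits_subset_group_roots:
  "Leaf \<notin> set ts \<Longrightarrow> t \<in> set (group_roots B ts) \<Longrightarrow> set (exits B t) \<subseteq> set (group_roots B ts)"
proof (induction B ts rule: group_roots.induct)
  case (2 B u ts)
  have "Leaf \<notin> set (exits B u @ ts)" and "u \<noteq> Leaf"
    using 2 by (auto simp: Leaf_notin_exits)
  note step = this
  have "set (exits B t) \<subseteq> set (group_roots B (exits B u @ ts))"
  proof (cases "t = u")
    case True
    then show ?thesis
      using set_subset_group_roots[OF step(1), of B] by simp
  next
    case False
    then show ?thesis
      using 2 step by simp
  qed
  then show ?case
    using step(2) by (simp add: subset_insertI2)
qed simp

text \<open>A charging argument. Nodes with \<open>q > 0\<close> are paid from
  \<open>2 * q - 1\<close>, the budget of a binary tree in which \<open>q\<close> halves per level.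
  A node with \<open>q = 0\<close> is paid from the term \<open>j = d\<close> of the sum, of which
  its subtree owns the share \<open>size t / W\<close>; the shares of two siblings add up to at most
  that of their parent.\<close>

lemma length_group_nodes_le:
  assumes "W > 0" "size t \<le> W" "d = 0 \<longrightarrow> q > 0"
  shows "real (length (group_nodes B W d q t)) \<le>
           real (2 * q - 1) + size t / W * (\<Sum>j\<in>{d..B}. sqrt (real B / real j))"
  using assms
proof (induction B W d q t rule: group_nodes.induct)
  case (2 B W d q l x r)
  define w where "w = size (Node l x r)"
  define F where "F = (\<lambda>d. \<Sum>j=d..B. sqrt (B / j))"
  have F_nonneg: "F d \<ge> 0" for d
    unfolding F_def by (intro sum_nonneg) auto
  have F_mono: "F (Suc d) \<le> F d"
    unfolding F_def by (intro sum_mono2) auto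
  show ?case
  proof (cases "fits B W d q w")
    case True
    let ?l = "real (length (group_nodes B W (Suc d) (q div 2) l))"
    let ?r = "real (length (group_nodes B W (Suc d) (q div 2) r))"
    define a where "a = 2 * (q div 2) - 1"
    define b where "b = 2 * q - 1"
    have "?l \<le> a + size l / W * F (Suc d)" "?r \<le> a + size r / W * F (Suc d)"
      using 2 True unfolding F_def w_def a_def by auto
    moreover have "size l / W * F (Suc d) + size r / W * F (Suc d) \<le> w / W * F (Suc d)"
      using F_nonneg[of "Suc d"] \<open>W > 0\<close>
      by (simp add: w_def field_simps)
    ultimately have lr: "?l + ?r \<le> 2 * real a + w / W * F (Suc d)"
      by linarith
    have "1 + ?l + ?r \<le> b + w / W * F d"
    proof (cases "q = 0")
      case False
      \<comment> \<open>The budget covers the node and the budgets of both children; for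
        \<open>q = 1\<close> the latter are 0 by truncated subtraction.\<close>
      then have "1 + 2 * a \<le> b"
        unfolding a_def b_def by (cases "q div 2") auto
      then have "1 + 2 * real a \<le> real b"
        by linarith
      moreover have "w / W * F (Suc d) \<le> w / W * F d"
        using F_mono by (intro mult_left_mono) auto
      ultimately show ?thesis
        using lr by linarith
    next
      case q: True
      then have "d * W\<^sup>2 \<le> B * w\<^sup>2"
        using True by (simp add: fits_def)
      then have le: "real d * (real W)\<^sup>2 \<le> real B * (real w)\<^sup>2"
        by (metis of_nat_le_iff of_nat_mult of_nat_power)
      have "d > 0" using 2 q by auto
      have "w \<le> W" using 2 by (auto simp: w_def)
      then have "real B * (real w)\<^sup>2 \<le> real B * (real W)\<^sup>2"
        by (intro mult_left_mono power_mono) auto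
      with le have "real d * (real W)\<^sup>2 \<le> real B * (real W)\<^sup>2" by linarith
      \<comment> \<open>This puts \<open>j = d\<close> inside the range of the sum, so that its term
        can be split off.\<close>
      then have "d \<le> B" using \<open>W > 0\<close> by simp
      then have split: "F d = sqrt (B / d) + F (Suc d)"
        unfolding F_def by (simp add: sum.atLeast_Suc_atMost)
      \<comment> \<open>The admission test in squared form: the share \<open>w / W\<close> of the
        term \<open>sqrt (B / d)\<close> is at least 1 and pays for this node.\<close>
      have "(real W / w)\<^sup>2 \<le> B / d"
        using le \<open>d > 0\<close> by (simp add: w_def field_simps)
      then have "real W / w \<le> sqrt (B / d)"
        by (rule real_le_rsqrt)
      then have "1 \<le> w / W * sqrt (B / d)"
        using \<open>W > 0\<close> by (simp add: w_def field_simps)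
      then have "1 + w / W * F (Suc d) \<le> w / W * F d"
        unfolding split by (simp add: algebra_simps)
      then show ?thesis
        using lr q by (simp add: a_def)
    qed
    then show ?thesis
      using True by (simp add: w_def F_def b_def)
  next
    case False
    then show ?thesis
      using F_nonneg[of d] by (simp add: w_def F_def)
  qed
qed simp

lemma sum_inverse_sqrt_le: "(\<Sum>j=1..n. 1 / sqrt (real j)) \<le> 2 * sqrt n"
proof (induction n)
  case (Suc n)
  define a b where "a = sqrt (real n)" and "b = sqrt (real (Suc n))"
  have "b > 0" "b\<^sup>2 = a\<^sup>2 + 1"
    by (auto simp: a_def b_def)
  \<comment> \<open>With \<open>b\<^sup>2 = a\<^sup>2 + 1\<close> this says
    \<open>1 / b \<le> 2 * (b - a)\<close>, so the sum telescopes.\<close>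
  have "2 * a * b \<le> a\<^sup>2 + b\<^sup>2"
    by (rule sum_squares_bound)
  then have "(2 * a + 1 / b) * b \<le> 2 * b * b"
    using \<open>b > 0\<close> \<open>b\<^sup>2 = a\<^sup>2 + 1\<close> by (simp add: algebra_simps power2_eq_square)
  then have "2 * a + 1 / b \<le> 2 * b"
    using \<open>b > 0\<close> by (meson mult_le_cancel_right_pos)
  then show ?case
    using Suc.IH by (simp add: a_def b_def)
qed simp


lemma length_group_le:
  assumes "B \<ge> 1" "t \<noteq> Leaf"
  shows "length (group B t) \<le> 4 * B"
proof -
  \<comment> \<open>The term \<open>j = 0\<close> vanishes because division by 0 yields 0.\<close>
  have "(\<Sum>j\<in>{0..B}. sqrt (real B / real j)) = (\<Sum>j=1..B. sqrt (real B / real j))"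
    by (simp add: sum.atLeast_Suc_atMost)
  also have "\<dots> = sqrt B * (\<Sum>j=1..B. 1 / sqrt (real j))"
    by (simp add: sum_distrib_left real_sqrt_divide)
  also have "\<dots> \<le> sqrt B * (2 * sqrt B)"
    by (intro mult_left_mono sum_inverse_sqrt_le) auto
  also have "sqrt B * (2 * sqrt B) = 2 * B"
    by simp
  finally have "(\<Sum>j\<in>{0..B}. sqrt (real B / real j)) \<le> 2 * B" .
  moreover have "size t > 0"
    using assms by (cases t) auto
  ultimately have "real (length (group B t)) \<le> real (2 * B - 1) + 2 * B"
    using length_group_nodes_le[of "size t" t 0 B B] assms by simp
  then show ?thesis
    by linarith
qed

section \<open>Memory transfers along a path\<close>

text \<open>By distinctness the nodes of a group occur only in its own interval of at most
  \<open>4 * B\<close> consecutive cells. The interval may start anywhere inside a block, so it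
  meets up to 5 blocks rather than 4.\<close>

lemma memory_transfers_concat_le:
  assumes "B \<ge> 1" and dist: "distinct (concat gs)"
    and len: "\<And>g. g \<in> set gs \<Longrightarrow> length g \<le> 4 * B"
    and G: "G \<subseteq> set gs" and p: "set p \<subseteq> \<Union> (set ` G)"
  shows "memory_transfers B (concat gs) p \<le> 5 * card G"
proof -
  define L where "L = concat gs"
  define blocks where "blocks = (\<lambda>g. {i div B | i. i < length L \<and> L ! i \<in> set g})"
  have fin: "finite G" using G by (rule finite_subset) simp
  have card_blocks: "finite (blocks g) \<and> card (blocks g) \<le> 5" if "g \<in> G" for g
  proof -
    from that G obtain us vs where gs: "gs = us @ g # vs"
      by (metis split_list subsetD)
    define a where "a = length (concat us)"
    have L: "L = concat us @ g @ concat vs"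
      by (simp add: L_def gs)
    have "a \<le> i \<and> i < a + 4 * B" if "i < length L" "L ! i \<in> set g" for i
    proof -
      have disj: "set g \<inter> set (concat us) = {}" "set g \<inter> set (concat vs) = {}"
        using dist unfolding L_def[symmetric] L distinct_append by auto
      have "a \<le> i"
        using that(2) disj(1) nth_mem[of i "concat us"]
        by (force simp: L nth_append a_def simp del: nth_mem)
      moreover have "i < a + length g"
      proof (rule ccontr)
        assume "\<not> ?thesis"
        then have "L ! i \<in> set (concat vs)"
          using that(1) by (auto simp: L a_def nth_append simp del: set_concat intro!: nth_mem)
        then show False using that(2) disj(2) by blast
      qed
      ultimately show ?thesis
        using len[of g] \<open>g \<in> G\<close> G by fastforce
    qed
    then have "blocks g \<subseteq> {a div B..a div B + 4}"
    proof -
      have "i div B \<in> {a div B..a div B + 4}" if "a \<le> i" "i < a + 4 * B" for i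
      proof -
        have "i div B \<le> (a + 4 * B) div B" "a div B \<le> i div B"
          by (rule div_le_mono, use that in simp)+
        moreover have "(a + 4 * B) div B = 4 + a div B"
          using \<open>B \<ge> 1\<close> by (intro div_mult_self1) simp
        ultimately show ?thesis
          by simp
      qed
      then show ?thesis
        unfolding blocks_def using \<open>\<And>i. i < length L \<Longrightarrow> L ! i \<in> set g \<Longrightarrow> a \<le> i \<and> i < a + 4 * B\<close>
        by blast
    qed
    from finite_subset[OF this] card_mono[OF _ this] show ?thesis
      by simp
  qed
  have "{i div B | i. i < length L \<and> L ! i \<in> set p} \<subseteq> (\<Union>g\<in>G. blocks g)"
    using p unfolding blocks_def by blast
  then have "memory_transfers B L p \<le> card (\<Union>g\<in>G. blocks g)"
    unfolding memory_transfers_def using fin card_blocks by (intro card_mono) auto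
  also have "\<dots> \<le> (\<Sum>g\<in>G. card (blocks g))"
    by (rule card_UN_le[OF fin])
  also have "\<dots> \<le> (\<Sum>g\<in>G. 5)"
    using card_blocks by (intro sum_mono) auto
  finally show ?thesis
    by (simp add: L_def)
qed

section \<open>Following a path from group to group\<close>

lemma root_path_nonempty: "root_path t p \<Longrightarrow> p \<noteq> []"
  by (induction rule: root_path.induct) auto

lemma root_path_size_pos: "root_path t p \<Longrightarrow> size t > 0"
  by (induction rule: root_path.induct) auto

lemma root_path_length_le: "root_path t p \<Longrightarrow> length p \<le> size t"
  by (induction rule: root_path.induct) auto

text \<open>The path is split at its first rejected node, the root of \<open>u\<close>. The failed
  test is recorded with the depth \<open>d + length p1\<close>, since it yields both the length
  spent in the group and the loss of weight.\<close>

lemma root_path_leaves_group: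
  assumes "root_path t p" "\<not> set p \<subseteq> set (group_nodes B W d q t)"
  shows "\<exists>p1 p2 u. p = p1 @ p2 \<and> set p1 \<subseteq> set (group_nodes B W d q t) \<and>
           u \<in> set (group_exits B W d q t) \<and> root_path u p2 \<and>
           \<not> fits B W (d + length p1) (q div 2 ^ length p1) (size u)"
  using assms
proof (induction arbitrary: d q rule: root_path.induct)
  case (here l x r)
  then have "\<not> fits B W d q (size (Node l x r))"
    by (auto split: if_splits)
  then show ?case
    by (intro exI[of _ "[]"] exI[of _ "[x]"] exI[of _ "Node l x r"]) (auto intro: root_path.here)
next
  case (left l p x r)
  show ?case
  proof (cases "fits B W d q (size (Node l x r))")
    case True
    with left.prems have "\<not> set p \<subseteq> set (group_nodes B W (Suc d) (q div 2) l)"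
      by auto
    from left.IH[OF this] obtain p1 p2 u where
      "p = p1 @ p2" "set p1 \<subseteq> set (group_nodes B W (Suc d) (q div 2) l)"
      "u \<in> set (group_exits B W (Suc d) (q div 2) l)" "root_path u p2"
      "\<not> fits B W (Suc d + length p1) (q div 2 div 2 ^ length p1) (size u)"
      by blast
    with True show ?thesis
      by (intro exI[of _ "x # p1"] exI[of _ p2] exI[of _ u]) (auto simp: div_mult2_eq)
  next
    case False
    then show ?thesis
      by (intro exI[of _ "[]"] exI[of _ "x # p"] exI[of _ "Node l x r"])
         (use left.hyps in \<open>auto intro: root_path.left\<close>)
  qed
next
  case (right r p l x)
  show ?case
  proof (cases "fits B W d q (size (Node l x r))")
    case True
    with right.prems have "\<not> set p \<subseteq> set (group_nodes B W (Suc d) (q div 2) r)"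
      by auto
    from right.IH[OF this] obtain p1 p2 u where
      "p = p1 @ p2" "set p1 \<subseteq> set (group_nodes B W (Suc d) (q div 2) r)"
      "u \<in> set (group_exits B W (Suc d) (q div 2) r)" "root_path u p2"
      "\<not> fits B W (Suc d + length p1) (q div 2 div 2 ^ length p1) (size u)"
      by blast
    with True show ?thesis
      by (intro exI[of _ "x # p1"] exI[of _ p2] exI[of _ u]) (auto simp: div_mult2_eq)
  next
    case False
    then show ?thesis
      by (intro exI[of _ "[]"] exI[of _ "x # p"] exI[of _ "Node l x r"])
         (use right.hyps in \<open>auto intro: root_path.right\<close>)
  qed
qed

text \<open>Induction along the groups of the path. \<open>m\<close> counts the groups that are left
  again; the last group, which need not pay for anything, turns this into \<open>Suc m\<close>. The
  inequality is kept for all \<open>\<theta>\<close> because the right value depends on the length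
  and weight of the whole path and has to be the same in every step of the induction.\<close>

lemma root_path_group_cover:
  assumes "B \<ge> 1" "Leaf \<notin> set ts" "t \<in> set (group_roots B ts)" "root_path t p"
  shows "\<exists>m G. G \<subseteq> group B ` set (group_roots B ts) \<and> set p \<subseteq> \<Union> (set ` G) \<and>
           card G \<le> Suc m \<and>
           real m * log 2 (1 + real B) \<le> real (length p) - 1 \<and>
           (\<forall>\<theta>>0. real m * (1 + ln (real B / \<theta>)) \<le> 2 * ln (size t) + (real (length p) - 1) / \<theta>)"
  using assms(3,4)
proof (induction "length p" arbitrary: t p rule: less_induct)
  case less
  show ?case
  proof (cases "set p \<subseteq> set (group B t)")
    case True
    have "length p \<ge> 1" "size t \<ge> 1"
      using root_path_nonempty[OF less.prems(2)] root_path_size_pos[OF less.prems(2)]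
      by (simp_all add: Suc_le_eq)
    then show ?thesis
      using True less.prems(1) by (intro exI[of _ 0] exI[of _ "{group B t}"]) auto
  next
    case False
    from root_path_leaves_group[OF less.prems(2) this] obtain p1 p2 u where
      p: "p = p1 @ p2" and p1: "set p1 \<subseteq> set (group B t)" and
      u: "u \<in> set (exits B t)" and p2: "root_path u p2" and
      nfit: "\<not> fits B (size t) (length p1) (B div 2 ^ length p1) (size u)"
      by auto
    define e where "e = real (length p1)"
    \<comment> \<open>A group always contains its root, by \<open>fits_root\<close>, so the
      remaining path is shorter.\<close>
    have "p1 \<noteq> []"
      using nfit by (intro notI) simp
    then have "e > 0" and shorter: "length p2 < length p"
      by (auto simp: p e_def)
    have "u \<in> set (group_roots B ts)"
      using exits_subset_group_roots[OF assms(2) less.prems(1)] u by auto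
    from less.hyps[OF shorter this p2] obtain m G where
      G: "G \<subseteq> group B ` set (group_roots B ts)" "set p2 \<subseteq> \<Union> (set ` G)" "card G \<le> Suc m" and
      m1: "real m * log 2 (1 + real B) \<le> real (length p2) - 1" and
      m2: "\<And>\<theta>. \<theta> > 0 \<Longrightarrow>
             real m * (1 + ln (real B / \<theta>)) \<le> 2 * ln (size u) + (real (length p2) - 1) / \<theta>"
      by blast
    have pos: "size u > 0" "size t > 0" "B > 0"
      using p2 less.prems(2) \<open>B \<ge> 1\<close> by (auto dest: root_path_size_pos)
    \<comment> \<open>The exit fails both clauses of \<open>fits\<close>: the first failure bounds
      the length spent in the group, the second one, used further below, the weight.\<close>
    have "B < 2 ^ length p1"
      using nfit by (auto simp: fits_def div_greater_zero_iff)
    then have "Suc B \<le> 2 ^ length p1"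
      by (rule Suc_leI)
    then have "real (Suc B) \<le> real (2 ^ length p1)"
      by (simp only: of_nat_le_iff)
    then have "1 + real B \<le> 2 ^ length p1"
      by simp
    then have "log 2 (1 + real B) \<le> log 2 (2 ^ length p1)"
      by (intro log_mono) auto
    then have lg: "log 2 (1 + real B) \<le> e"
      by (simp add: e_def log_nat_power)
    have "B * (size u)\<^sup>2 \<le> length p1 * (size t)\<^sup>2"
      using nfit by (simp add: fits_def)
    then have "real B * (real (size u))\<^sup>2 \<le> e * (real (size t))\<^sup>2"
      unfolding e_def by (metis of_nat_le_iff of_nat_mult of_nat_power)
    moreover have "real (size u) > 0" "real (size t) > 0" "real B > 0"
      using pos by (simp_all only: of_nat_0_less_iff)
    ultimately have "ln (real B * (real (size u))\<^sup>2) \<le> ln (e * (real (size t))\<^sup>2)"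
      by (intro ln_mono mult_pos_pos zero_less_power)
    then have ln_size: "ln B + 2 * ln (size u) \<le> ln e + 2 * ln (size t)"
      using \<open>real (size u) > 0\<close> \<open>real (size t) > 0\<close> \<open>real B > 0\<close> \<open>e > 0\<close>
      by (simp only: ln_mult_pos zero_less_power ln_realpow of_nat_numeral)
    have bound: "real (Suc m) * (1 + ln (real B / \<theta>)) \<le> 2 * ln (size t) + (real (length p) - 1) / \<theta>"
      if "\<theta> > 0" for \<theta>
    proof -
      have "1 + ln (e / \<theta>) \<le> e / \<theta>"
        using ln_le_minus_one[of "e / \<theta>"] \<open>e > 0\<close> that by simp
      then have "1 + ln (real B / \<theta>) + 2 * ln (size u) \<le> 2 * ln (size t) + e / \<theta>"
        using ln_size pos \<open>e > 0\<close> that by (simp add: ln_div)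
      \<comment> \<open>\<open>length p - 1\<close> counts edges, and exactly \<open>e\<close> of
        them lead from the root of this group to the root of the next.\<close>
      moreover have "(real (length p) - 1) / \<theta> = e / \<theta> + (real (length p2) - 1) / \<theta>"
        by (simp add: p e_def add_divide_distrib diff_divide_distrib)
      ultimately show ?thesis
        using m2[OF that] by (simp add: algebra_simps)
    qed
    have "card (insert (group B t) G) \<le> Suc (Suc m)"
      using G(3) card_insert_le_m1[of "Suc (Suc m)" G "group B t"] by simp
    moreover have "real (Suc m) * log 2 (1 + real B) \<le> real (length p) - 1"
      using m1 lg by (simp add: p e_def algebra_simps)
    moreover have "insert (group B t) G \<subseteq> group B ` set (group_roots B ts)"
      using G(1) less.prems(1) by simp
    moreover have "set p \<subseteq> \<Union> (set ` insert (group B t) G)"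
      using G(2) p1 unfolding p by auto
    ultimately show ?thesis
      using bound by (intro exI[of _ "Suc m"] exI[of _ "insert (group B t) G"] conjI allI impI)
  qed
qed

section \<open>The three regimes of \<open>D\<close>, with explicit constants\<close>

lemma log_over_scaled:
  fixes \<beta> x :: real
  assumes "\<beta> > 0" "\<beta> * x \<ge> 1"
  shows "ln 2 / max 1 (ln (1 + 1 / \<beta>)) * log 2 (1 + x) \<le> 1 + ln (\<beta> * x)"
proof -
  define K where "K = max 1 (ln (1 + 1 / \<beta>))"
  have "x > 0"
    using assms by (intro zero_less_mult_pos[of \<beta> x]) auto
  \<comment> \<open>The right side expands to \<open>\<beta> * x + x\<close>. The aim is to turn the
    factor \<open>1 + ln (\<beta> * x)\<close> of the tangent estimate into a multiple of
    \<open>log 2 (1 + x)\<close>.\<close>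
  have "1 + x \<le> (1 + 1 / \<beta>) * (\<beta> * x)"
    using assms by (simp add: algebra_simps)
  then have "ln (1 + x) \<le> ln ((1 + 1 / \<beta>) * (\<beta> * x))"
    using \<open>x > 0\<close> by simp
  also have "\<dots> = ln (1 + 1 / \<beta>) + ln (\<beta> * x)"
    using assms \<open>x > 0\<close> by (intro ln_mult_pos) (auto intro: add_pos_pos)
  also have "\<dots> \<le> K + K * ln (\<beta> * x)"
    using assms by (intro add_mono) (auto simp: K_def mult_le_cancel_right1)
  finally have "ln (1 + x) / K \<le> 1 + ln (\<beta> * x)"
    by (simp add: K_def divide_le_eq algebra_simps)
  then show ?thesis
    by (simp add: log_def K_def)
qed

text \<open>Each regime bounds \<open>m\<close> by its own factor times the claimed expression: 1,
  \<open>(2 + \<beta>) * K / ln 2\<close> and \<open>1 + 2 / \<beta>\<close>. The bracket in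
  \<open>C\<close> dominates all three, and the 10 comes from
  \<open>5 * (1 + m) \<le> 5 * (z + z)\<close>, where \<open>z\<close> bounds both 1 and
  \<open>m\<close>.\<close>

lemma transfers_bounds:
  fixes \<beta> b D n m :: real and transfers :: nat
  assumes "\<beta> > 0" "b \<ge> 1" "D \<ge> 0" "n \<ge> 0" "m \<ge> 0" and pos: "D > 0 \<Longrightarrow> n > 0"
    and transfers: "transfers \<le> 5 * (1 + m)"
    and m1: "m * log 2 (1 + b) \<le> D"
    and m2: "\<And>\<theta>. \<theta> > 0 \<Longrightarrow> m * (1 + ln (b / \<theta>)) \<le> 2 * n + D / \<theta>"
  defines "C \<equiv> 10 * (1 + (2 + \<beta>) * max 1 (ln (1 + 1 / \<beta>)) / ln 2 + 2 / \<beta>)"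
  shows "transfers \<le> C * max 1 (D / log 2 (1 + b))" (is ?small)
    and "D \<le> \<beta> * (b * n) \<Longrightarrow> transfers \<le> C * max 1 (n / log 2 (1 + b * n / D))"
    and "\<beta> * (b * n) \<le> D \<Longrightarrow> transfers \<le> C * max 1 (D / b)"
proof -
  define K where "K = max 1 (ln (1 + 1 / \<beta>))"
  have "K \<ge> 1" by (simp add: K_def)
  have C: "C = 10 * (1 + (2 + \<beta>) * K / ln 2 + 2 / \<beta>)"
    by (simp add: C_def K_def)
  have bound: "transfers \<le> C * max 1 y"
    if "m \<le> c * y" "c \<le> 1 + (2 + \<beta>) * K / ln 2 + 2 / \<beta>" "c \<ge> 0" for c y
  proof -
    define E where "E = 1 + (2 + \<beta>) * K / ln 2 + 2 / \<beta>"
    have "E \<ge> 1" using \<open>\<beta> > 0\<close> \<open>K \<ge> 1\<close> by (simp add: E_def)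
    have "m \<le> c * max 1 y"
      using that by (meson max.cobounded2 mult_left_mono order_trans)
    also have "\<dots> \<le> E * max 1 y"
      using that by (intro mult_right_mono) (auto simp: E_def)
    finally have "m \<le> E * max 1 y" .
    moreover have "1 * 1 \<le> E * max 1 y"
      using \<open>E \<ge> 1\<close> by (intro mult_mono) auto
    moreover define z where "z = E * max 1 y"
    ultimately have "transfers \<le> 10 * z"
      using transfers by simp
    then show ?thesis
      by (simp only: C E_def z_def mult.assoc)
  qed
  have nonneg: "(2 + \<beta>) * K / ln 2 \<ge> 0" "2 / \<beta> \<ge> 0"
    using \<open>\<beta> > 0\<close> \<open>K \<ge> 1\<close> by auto
  have "log 2 (1 + b) \<ge> 1"
    using \<open>b \<ge> 1\<close> by (simp add: le_log_iff)
  show ?small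
  proof (rule bound[of 1])
    show "m \<le> 1 * (D / log 2 (1 + b))"
      using m1 \<open>log 2 (1 + b) \<ge> 1\<close> by (simp add: le_divide_eq)
  qed (use nonneg in linarith)+
  show "transfers \<le> C * max 1 (D / b)" if "\<beta> * (b * n) \<le> D"
  proof (rule bound[of "1 + 2 / \<beta>"])
    have "m \<le> 2 * n + D / b"
      using m2[of b] \<open>b \<ge> 1\<close> by simp
    moreover have "n \<le> D / b / \<beta>"
      using that \<open>b \<ge> 1\<close> \<open>\<beta> > 0\<close> by (simp add: field_simps)
    ultimately have "m \<le> D / b + 2 * (D / b / \<beta>)"
      by linarith
    then show "m \<le> (1 + 2 / \<beta>) * (D / b)"
      using \<open>\<beta> > 0\<close> \<open>b \<ge> 1\<close> by (simp add: field_simps)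
  qed (use nonneg in auto)
  show "transfers \<le> C * max 1 (n / log 2 (1 + b * n / D))" if D: "D \<le> \<beta> * (b * n)"
  \<comment> \<open>The intended \<open>\<theta> = D / (\<beta> * n)\<close> must be positive, so
    \<open>D = 0\<close> is separate; there the first bound forces \<open>m = 0\<close>.\<close>
  proof (cases "D = 0")
    case True
    have "m \<le> m * log 2 (1 + b)"
      using \<open>log 2 (1 + b) \<ge> 1\<close> \<open>m \<ge> 0\<close> by (simp add: mult_le_cancel_left1)
    then have "m \<le> 0" using m1 True by simp
    then show ?thesis
      by (intro bound[of 0]) (use nonneg in auto)
  next
    case False
    then have "D > 0" "n > 0" using \<open>D \<ge> 0\<close> pos by auto
    define x where "x = b * n / D"
    have "\<beta> * x \<ge> 1" "x > 0"
      using D \<open>D > 0\<close> \<open>n > 0\<close> \<open>b \<ge> 1\<close> by (auto simp: x_def field_simps)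
    define y where "y = ln 2 / K * log 2 (1 + x)"
    have "y > 0"
      using \<open>x > 0\<close> \<open>K \<ge> 1\<close> by (simp add: y_def)
    have "y \<le> 1 + ln (\<beta> * x)"
      using log_over_scaled[OF \<open>\<beta> > 0\<close> \<open>\<beta> * x \<ge> 1\<close>] by (simp add: y_def K_def)
    then have "m * y \<le> m * (1 + ln (\<beta> * x))"
      using \<open>m \<ge> 0\<close> by (rule mult_left_mono)
    \<comment> \<open>This \<open>\<theta>\<close> balances the two terms:
      \<open>D / \<theta> = \<beta> * n\<close> is of the same order as \<open>2 * n\<close>, and
      \<open>b / \<theta> = \<beta> * x\<close>.\<close>
    also have "\<dots> \<le> 2 * n + \<beta> * n"
      using m2[of "D / (\<beta> * n)"] \<open>D > 0\<close> \<open>n > 0\<close> \<open>\<beta> > 0\<close> by (simp add: x_def mult_ac)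
    finally have "m \<le> (2 + \<beta>) * n / y"
      using \<open>y > 0\<close> by (simp add: field_simps)
    also have "\<dots> = (2 + \<beta>) * K / ln 2 * (n / log 2 (1 + x))"
      by (simp add: y_def)
    finally show ?thesis
      unfolding x_def using nonneg by (intro bound) auto
  qed
qed

section \<open>The transfer bounds for the layout of a tree\<close>

lemma mset_tree_layout_single: "mset (tree_layout B [T]) = mset (inorder T)"
  by (simp add: mset_tree_layout)

lemma distinct_tree_layout:
  "distinct (inorder T) \<Longrightarrow> distinct (tree_layout B [T])"
  using mset_eq_imp_distinct_iff[OF mset_tree_layout_single[of B T]] by simp

lemma set_tree_layout: "set (tree_layout B [T]) = set_tree T"
  using mset_eq_setD[OF mset_tree_layout_single[of B T]] by simp

lemma tree_layout_transfers:
  assumes "\<beta> > 0" "B \<ge> 1" "distinct (inorder T)" "root_path T p"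
  shows "let D = real (path_length p); n = log 2 (real (size T)); b = real B;
             transfers = real (memory_transfers B (tree_layout B [T]) p);
             C = 10 * (1 + (2 + \<beta>) * max 1 (ln (1 + 1 / \<beta>)) / ln 2 + 2 / \<beta>)
         in transfers \<le> C * max 1 (D / log 2 (1 + b)) \<and>
            (D \<le> \<beta> * (b * n) \<longrightarrow> transfers \<le> C * max 1 (n / log 2 (1 + b * n / D))) \<and>
            (\<beta> * (b * n) \<le> D \<longrightarrow> transfers \<le> C * max 1 (D / b))"
proof -
  have "size T > 0"
    using assms(4) by (rule root_path_size_pos)
  then have "T \<noteq> Leaf" by auto
  have "p \<noteq> []"
    using assms(4) by (rule root_path_nonempty)
  then have D: "real (length p) - 1 = real (path_length p)"
    by (cases p) (auto simp: path_length_def)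
  have roots: "Leaf \<notin> set (group_roots B [T])"
    using Leaf_notin_group_roots .
  have "Leaf \<notin> set [T]" "T \<in> set (group_roots B [T])"
    using \<open>T \<noteq> Leaf\<close> by simp_all
  from root_path_group_cover[OF assms(2) this assms(4)] obtain m G where
    G: "G \<subseteq> group B ` set (group_roots B [T])" "set p \<subseteq> \<Union> (set ` G)" "card G \<le> Suc m" and
    m1: "real m * log 2 (1 + real B) \<le> real (path_length p)" and
    m2: "\<forall>\<theta>>0. real m * (1 + ln (real B / \<theta>)) \<le> 2 * ln (size T) + real (path_length p) / \<theta>"
    unfolding D by (elim exE conjE)
  have "memory_transfers B (tree_layout B [T]) p \<le> 5 * card G"
    unfolding tree_layout_def
  proof (rule memory_transfers_concat_le)
    show "distinct (concat (map (group B) (group_roots B [T])))"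
      using distinct_tree_layout[OF assms(3)] unfolding tree_layout_def .
    show "length g \<le> 4 * B" if "g \<in> set (map (group B) (group_roots B [T]))" for g
    proof -
      from that obtain t where "t \<in> set (group_roots B [T])" "g = group B t"
        unfolding set_map by (rule imageE)
      with roots show ?thesis
        using length_group_le[OF assms(2), of t] by metis
    qed
    show "G \<subseteq> set (map (group B) (group_roots B [T]))"
      unfolding set_map by (rule G(1))
  qed (rule assms(2), rule G(2))
  also have "\<dots> \<le> 5 * Suc m"
    using G(3) by simp
  finally have "real (memory_transfers B (tree_layout B [T]) p) \<le> real (5 * Suc m)"
    by (simp only: of_nat_le_iff)
  then have transfers: "real (memory_transfers B (tree_layout B [T]) p) \<le> 5 * (1 + real m)"
    by simp
  \<comment> \<open>Passing from the natural to the binary logarithm loses nothing in this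
    direction, as \<open>ln 2 < 1\<close>.\<close>
  have "ln (size T) * ln 2 \<le> ln (size T)"
    using \<open>size T > 0\<close> ln_2_less_1 by (intro mult_left_le) auto
  then have "ln (size T) \<le> log 2 (size T)"
    by (simp add: log_def le_divide_eq)
  then have m2': "real m * (1 + ln (real B / \<theta>)) \<le> 2 * log 2 (size T) + real (path_length p) / \<theta>"
    if "\<theta> > 0" for \<theta>
    using m2[rule_format, OF that] by linarith
  have "length p \<le> size T"
    using assms(4) by (rule root_path_length_le)
  then have "log 2 (size T) > 0" if "path_length p > 0"
    using that by (simp add: path_length_def)
  then have pos: "log 2 (real (size T)) > 0" if "real (path_length p) > 0"
    using that by simp
  have n: "log 2 (real (size T)) \<ge> 0" and b: "real B \<ge> 1"
    using \<open>size T > 0\<close> \<open>B \<ge> 1\<close> by auto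
  show ?thesis
    unfolding Let_def
    using transfers_bounds[OF assms(1) b of_nat_0_le_iff n of_nat_0_le_iff pos transfers m1 m2']
    by (intro conjI impI)
qed

section \<open>Symbolic execution\<close>

text \<open>A total-correctness triple with a time bound and an overflow check at every intermediate
  state. \<open>T\<close> is only an upper bound, so that branches of different lengths can be
  joined. Boundedness of the start state is a premise inside the definition, so that
  \<open>reaches_trans\<close> can hand it on by itself.\<close>

definition reaches ::
    "instr list \<Rightarrow> nat \<Rightarrow> nat \<Rightarrow> (nat \<Rightarrow> (nat \<Rightarrow> nat) \<Rightarrow> (nat \<Rightarrow> nat) \<Rightarrow> bool)
     \<Rightarrow> nat \<Rightarrow> (nat \<Rightarrow> nat) \<Rightarrow> (nat \<Rightarrow> nat) \<Rightarrow> bool" where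
  "reaches P M T Q n r m \<longleftrightarrow>
     (word_bounded M \<lparr>pc = n, reg = r, mem = m\<rparr> \<longrightarrow>
      (\<exists>t\<le>T. (\<forall>i\<le>t. word_bounded M (run P i \<lparr>pc = n, reg = r, mem = m\<rparr>)) \<and>
        (\<exists>n' r' m'. run P t \<lparr>pc = n, reg = r, mem = m\<rparr> = \<lparr>pc = n', reg = r', mem = m'\<rparr> \<and> Q n' r' m')))"

lemma run_0 [simp]: "run P 0 s = s"
  by (simp add: run_def)

lemma run_Suc: "run P (Suc t) s = run P t (step P s)"
  by (simp add: run_def funpow_swap1)

lemma run_add: "run P (t + u) s = run P u (run P t s)"
  by (simp add: run_def add.commute[of t] funpow_add)

lemma reaches_refl: "Q n r m \<Longrightarrow> reaches P M T Q n r m"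
  unfolding reaches_def by (intro impI exI[of _ 0]) auto

lemma reaches_trans:
  assumes "reaches P M T Q n r m" "\<And>n' r' m'. Q n' r' m' \<Longrightarrow> reaches P M U Q' n' r' m'"
    and "T + U \<le> V"
  shows "reaches P M V Q' n r m"
  unfolding reaches_def
proof
  assume "word_bounded M \<lparr>pc = n, reg = r, mem = m\<rparr>"
  with assms(1) obtain t n' r' m' where t: "t \<le> T"
    "\<And>i. i \<le> t \<Longrightarrow> word_bounded M (run P i \<lparr>pc = n, reg = r, mem = m\<rparr>)"
    "run P t \<lparr>pc = n, reg = r, mem = m\<rparr> = \<lparr>pc = n', reg = r', mem = m'\<rparr>" "Q n' r' m'"
    unfolding reaches_def by blast
  have "word_bounded M \<lparr>pc = n', reg = r', mem = m'\<rparr>"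
    using t(2)[of t] t(3) by simp
  with assms(2)[OF t(4)] obtain u n'' r'' m'' where u: "u \<le> U"
    "\<And>i. i \<le> u \<Longrightarrow> word_bounded M (run P i \<lparr>pc = n', reg = r', mem = m'\<rparr>)"
    "run P u \<lparr>pc = n', reg = r', mem = m'\<rparr> = \<lparr>pc = n'', reg = r'', mem = m''\<rparr>" "Q' n'' r'' m''"
    unfolding reaches_def by blast
  have "word_bounded M (run P i \<lparr>pc = n, reg = r, mem = m\<rparr>)" if "i \<le> t + u" for i
  proof (cases "i \<le> t")
    case False
    then have "run P i \<lparr>pc = n, reg = r, mem = m\<rparr> = run P (i - t) \<lparr>pc = n', reg = r', mem = m'\<rparr>"
      using run_add[of P t "i - t"] t(3) by simp
    with u(2)[of "i - t"] that show ?thesis by simp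
  qed (use t in simp)
  with t u assms(3) show "\<exists>t\<le>V. (\<forall>i\<le>t. word_bounded M (run P i \<lparr>pc = n, reg = r, mem = m\<rparr>)) \<and>
      (\<exists>n' r' m'. run P t \<lparr>pc = n, reg = r, mem = m\<rparr> = \<lparr>pc = n', reg = r', mem = m'\<rparr> \<and> Q' n' r' m')"
    by (intro exI[of _ "t + u"]) (auto simp: run_add)
qed

lemma reaches_mono:
  "reaches P M T Q n r m \<Longrightarrow> (\<And>n' r' m'. Q n' r' m' \<Longrightarrow> Q' n' r' m') \<Longrightarrow> T \<le> U
    \<Longrightarrow> reaches P M U Q' n r m"
  by (rule reaches_trans[of P M T Q n r m 0]) (auto intro: reaches_refl)

lemma reaches_mono_time: "reaches P M T Q n r m \<Longrightarrow> T \<le> U \<Longrightarrow> reaches P M U Q n r m"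
  by (rule reaches_mono)

text \<open>Only \<^const>\<open>Const\<close>, \<^const>\<open>Add\<close> and \<^const>\<open>Mul\<close> can create a number larger than those already held.\<close>

fun after :: "(nat \<Rightarrow> (nat \<Rightarrow> nat) \<Rightarrow> (nat \<Rightarrow> nat) \<Rightarrow> bool) \<Rightarrow> nat \<Rightarrow> instr
     \<Rightarrow> nat \<Rightarrow> (nat \<Rightarrow> nat) \<Rightarrow> (nat \<Rightarrow> nat) \<Rightarrow> bool" where
  "after F M (Const i c) n r m = (c \<le> M \<and> F (Suc n) (r(i := c)) m)"
| "after F M (Move i j) n r m = F (Suc n) (r(i := r j)) m"
| "after F M (Add i j k) n r m = (r j + r k \<le> M \<and> F (Suc n) (r(i := r j + r k)) m)"
| "after F M (Sub i j k) n r m = F (Suc n) (r(i := r j - r k)) m"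
| "after F M (Mul i j k) n r m = (r j * r k \<le> M \<and> F (Suc n) (r(i := r j * r k)) m)"
| "after F M (Div i j k) n r m = F (Suc n) (r(i := r j div r k)) m"
| "after F M (Load i j) n r m = F (Suc n) (r(i := m (r j))) m"
| "after F M (Store i j) n r m = F (Suc n) r (m(r i := r j))"
| "after F M (Jump l) n r m = F l r m"
| "after F M (JumpZero i l) n r m = F (if r i = 0 then l else Suc n) r m"

lemma reaches_step:
  assumes "T > 0" "n < length P" "after (reaches P M (T - 1) Q) M (P ! n) n r m"
  shows "reaches P M T Q n r m"
  unfolding reaches_def
proof
  define s where "s = \<lparr>pc = n, reg = r, mem = m\<rparr>"
  assume "word_bounded M \<lparr>pc = n, reg = r, mem = m\<rparr>"
  then have b: "word_bounded M s" "\<And>i. r i \<le> M" "\<And>a. m a \<le> M"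
    by (auto simp: s_def word_bounded_def)
  have step: "step P s = exec_instr (P ! n) s"
    using assms(2) by (simp add: step_def halted_def s_def)
  have "\<exists>n' r' m'. exec_instr (P ! n) s = \<lparr>pc = n', reg = r', mem = m'\<rparr> \<and>
     word_bounded M \<lparr>pc = n', reg = r', mem = m'\<rparr> \<and> reaches P M (T - 1) Q n' r' m'"
    using assms(3) b(2,3)
    by (cases "P ! n")
       (auto simp: s_def set_reg_def word_bounded_def intro: le_trans[OF diff_le_self] le_trans[OF div_le_dividend])
  then obtain n' r' m' t where
    *: "exec_instr (P ! n) s = \<lparr>pc = n', reg = r', mem = m'\<rparr>" "t \<le> T - 1"
    "\<And>i. i \<le> t \<Longrightarrow> word_bounded M (run P i \<lparr>pc = n', reg = r', mem = m'\<rparr>)"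
    "\<exists>n'' r'' m''. run P t \<lparr>pc = n', reg = r', mem = m'\<rparr> = \<lparr>pc = n'', reg = r'', mem = m''\<rparr> \<and> Q n'' r'' m''"
    unfolding reaches_def by blast
  have "word_bounded M (run P i s)" if "i \<le> Suc t" for i
    using that b(1) *(1,3) step by (cases i) (auto simp: run_Suc)
  with * step assms(1) show "\<exists>t\<le>T. (\<forall>i\<le>t. word_bounded M (run P i \<lparr>pc = n, reg = r, mem = m\<rparr>)) \<and>
      (\<exists>n' r' m'. run P t \<lparr>pc = n, reg = r, mem = m\<rparr> = \<lparr>pc = n', reg = r', mem = m'\<rparr> \<and> Q n' r' m')"
    unfolding s_def[symmetric]
    by (intro exI[of _ "Suc t"]) (auto simp: run_Suc)
qed

text \<open>Unlike \<open>reaches\<close> this counts steps exactly: for a numeral \<open>T\<close>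
  the simplifier unfolds it into the execution of \<open>T\<close> instructions, so the numeral has
  to be the length of the code path taken.\<close>

fun steps_to ::
    "instr list \<Rightarrow> nat \<Rightarrow> nat \<Rightarrow> (nat \<Rightarrow> (nat \<Rightarrow> nat) \<Rightarrow> (nat \<Rightarrow> nat) \<Rightarrow> bool)
     \<Rightarrow> nat \<Rightarrow> (nat \<Rightarrow> nat) \<Rightarrow> (nat \<Rightarrow> nat) \<Rightarrow> bool" where
  "steps_to P M 0 Q n r m = Q n r m"
| "steps_to P M (Suc T) Q n r m = (n < length P \<and> after (steps_to P M T Q) M (P ! n) n r m)"

lemma steps_to_numeral [simp]:
  "steps_to P M (numeral k) Q n r m =
     (n < length P \<and> after (steps_to P M (pred_numeral k) Q) M (P ! n) n r m)"
  by (simp add: numeral_eq_Suc)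

lemma after_mono: "after F M i n r m \<Longrightarrow> (\<And>n r m. F n r m \<Longrightarrow> G n r m) \<Longrightarrow> after G M i n r m"
  by (cases i) auto

lemma reaches_steps_to: "steps_to P M T Q n r m \<Longrightarrow> reaches P M T Q n r m"
proof (induction T arbitrary: n r m)
  case (Suc T)
  then show ?case
    by (intro reaches_step) (auto elim: after_mono)
qed (simp add: reaches_refl)

section \<open>Lists and trees represented in memory\<close>

definition holds :: "(nat \<Rightarrow> nat) \<Rightarrow> nat \<Rightarrow> nat list \<Rightarrow> bool" where
  "holds m a xs \<longleftrightarrow> (\<forall>i<length xs. m (a + i) = xs ! i)"

lemma holds_Nil [simp]: "holds m a []"
  by (simp add: holds_def)

lemma holds_Cons [simp]: "holds m a (x # xs) \<longleftrightarrow> m a = x \<and> holds m (Suc a) xs"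
  unfolding holds_def by (auto simp: nth_Cons less_Suc_eq_0_disj)

lemma holds_append [simp]: "holds m a (xs @ ys) \<longleftrightarrow> holds m a xs \<and> holds m (a + length xs) ys"
  by (induction xs arbitrary: a) auto

lemma holds_cong:
  "holds m a xs \<Longrightarrow> (\<And>i. a \<le> i \<Longrightarrow> i < a + length xs \<Longrightarrow> m' i = m i) \<Longrightarrow> holds m' a xs"
  by (simp add: holds_def)

fun linked :: "(nat \<Rightarrow> nat) \<Rightarrow> nat tree \<Rightarrow> bool" where
  "linked m Leaf \<longleftrightarrow> True"
| "linked m (Node l x r) \<longleftrightarrow>
     m (2 * x) = root_name l \<and> m (2 * x + 1) = root_name r \<and> linked m l \<and> linked m r"

fun sized :: "(nat \<Rightarrow> nat) \<Rightarrow> nat \<Rightarrow> nat tree \<Rightarrow> bool" where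
  "sized m a Leaf \<longleftrightarrow> True"
| "sized m a (Node l x r) \<longleftrightarrow> m (a + x) = size (Node l x r) \<and> sized m a l \<and> sized m a r"

section \<open>The program\<close>

text \<open>
  Registers 5 to 8 hold the multiples 2 to 5 of \<open>N + 1\<close>.  From these addresses on the memory contains
  the subtree sizes, the output (first used for the preorder), the stack of roots of pending groups,
  and the working stack.  Registers 9, 16 and 10 point behind the end of the last three.  In the last
  loop an entry of the working stack consists of a node, its depth \<open>d\<close> in the group and \<open>B div 2 ^ d\<close>,
  and register 20 holds the size of the subtree at the root of the group.
\<close>

definition layout_program :: "instr list" where
  "layout_program =
    [Const 3 1, Add 4 0 3, Add 5 4 4, Add 6 5 4, Add 7 6 4, Add 8 7 4, Move 9 6,
     Store 8 2, Add 10 8 3,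
     \<comment> \<open>9: list the nodes in preorder\<close>
     Sub 11 10 8, JumpZero 11 25, Sub 10 10 3, Load 12 10, JumpZero 12 9,
     Add 13 12 12, Load 14 13, Add 13 13 3, Load 15 13, Store 9 12, Add 9 9 3,
     Store 10 15, Add 10 10 3, Store 10 14, Add 10 10 3, Jump 9,
     \<comment> \<open>25: compute the subtree sizes, scanning the preorder backwards\<close>
     Sub 11 9 6, JumpZero 11 42, Sub 9 9 3, Load 12 9,
     Add 13 12 12, Load 14 13, Add 13 13 3, Load 15 13,
     Add 14 14 5, Load 14 14, Add 15 15 5, Load 15 15, Add 14 14 15, Add 14 14 3,
     Add 15 12 5, Store 15 14, Jump 25,
     Store 7 2, Add 16 7 3, Const 19 2, Const 21 0,
     \<comment> \<open>46: pop from the stack of the current group\<close>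
     Sub 11 10 8, JumpZero 11 89,
     Sub 10 10 3, Load 17 10, Sub 10 10 3, Load 18 10, Sub 10 10 3, Load 12 10,
     JumpZero 12 46, JumpZero 17 57, Jump 68,
     Add 13 12 5, Load 13 13, Mul 13 13 13, Mul 13 13 1, Mul 14 20 20, Mul 14 14 18,
     Sub 14 14 13, JumpZero 14 68,
     Store 16 12, Add 16 16 3, Jump 46,
     \<comment> \<open>68: put the node in the current group\<close>
     Add 13 12 12, Load 14 13, Add 13 13 3, Load 15 13, Store 9 12, Add 9 9 3,
     Add 18 18 3, Div 17 17 19,
     Store 10 15, Add 10 10 3, Store 10 18, Add 10 10 3, Store 10 17, Add 10 10 3,
     Store 10 14, Add 10 10 3, Store 10 18, Add 10 10 3, Store 10 17, Add 10 10 3, Jump 46,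
     \<comment> \<open>89: pop the root of the next group\<close>
     Sub 11 16 7, JumpZero 11 102, Sub 16 16 3, Load 12 16, Add 20 12 5, Load 20 20,
     Store 10 12, Add 10 10 3, Store 10 21, Add 10 10 3, Store 10 1, Add 10 10 3, Jump 46,
     Move 0 6]"

lemma length_layout_program [simp]: "length layout_program = 103"
  by (simp add: layout_program_def)

text \<open>Instruction fetch as rewrite rules, so that the program list is not unfolded during
  symbolic execution.\<close>

lemma layout_program_nth:
  "layout_program ! 0 = Const 3 1"
  "layout_program ! Suc 0 = Add 4 0 3"
  "layout_program ! 2 = Add 5 4 4"
  "layout_program ! 3 = Add 6 5 4"
  "layout_program ! 4 = Add 7 6 4"
  "layout_program ! 5 = Add 8 7 4"
  "layout_program ! 6 = Move 9 6"
  "layout_program ! 7 = Store 8 2"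
  "layout_program ! 8 = Add 10 8 3"
  "layout_program ! 9 = Sub 11 10 8"
  "layout_program ! 10 = JumpZero 11 25"
  "layout_program ! 11 = Sub 10 10 3"
  "layout_program ! 12 = Load 12 10"
  "layout_program ! 13 = JumpZero 12 9"
  "layout_program ! 14 = Add 13 12 12"
  "layout_program ! 15 = Load 14 13"
  "layout_program ! 16 = Add 13 13 3"
  "layout_program ! 17 = Load 15 13"
  "layout_program ! 18 = Store 9 12"
  "layout_program ! 19 = Add 9 9 3"
  "layout_program ! 20 = Store 10 15"
  "layout_program ! 21 = Add 10 10 3"
  "layout_program ! 22 = Store 10 14"
  "layout_program ! 23 = Add 10 10 3"
  "layout_program ! 24 = Jump 9"
  "layout_program ! 25 = Sub 11 9 6"
  "layout_program ! 26 = JumpZero 11 42"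
  "layout_program ! 27 = Sub 9 9 3"
  "layout_program ! 28 = Load 12 9"
  "layout_program ! 29 = Add 13 12 12"
  "layout_program ! 30 = Load 14 13"
  "layout_program ! 31 = Add 13 13 3"
  "layout_program ! 32 = Load 15 13"
  "layout_program ! 33 = Add 14 14 5"
  "layout_program ! 34 = Load 14 14"
  "layout_program ! 35 = Add 15 15 5"
  "layout_program ! 36 = Load 15 15"
  "layout_program ! 37 = Add 14 14 15"
  "layout_program ! 38 = Add 14 14 3"
  "layout_program ! 39 = Add 15 12 5"
  "layout_program ! 40 = Store 15 14"
  "layout_program ! 41 = Jump 25"
  "layout_program ! 42 = Store 7 2"
  "layout_program ! 43 = Add 16 7 3"
  "layout_program ! 44 = Const 19 2"
  "layout_program ! 45 = Const 21 0"
  "layout_program ! 46 = Sub 11 10 8"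
  "layout_program ! 47 = JumpZero 11 89"
  "layout_program ! 48 = Sub 10 10 3"
  "layout_program ! 49 = Load 17 10"
  "layout_program ! 50 = Sub 10 10 3"
  "layout_program ! 51 = Load 18 10"
  "layout_program ! 52 = Sub 10 10 3"
  "layout_program ! 53 = Load 12 10"
  "layout_program ! 54 = JumpZero 12 46"
  "layout_program ! 55 = JumpZero 17 57"
  "layout_program ! 56 = Jump 68"
  "layout_program ! 57 = Add 13 12 5"
  "layout_program ! 58 = Load 13 13"
  "layout_program ! 59 = Mul 13 13 13"
  "layout_program ! 60 = Mul 13 13 1"
  "layout_program ! 61 = Mul 14 20 20"
  "layout_program ! 62 = Mul 14 14 18"
  "layout_program ! 63 = Sub 14 14 13"
  "layout_program ! 64 = JumpZero 14 68"
  "layout_program ! 65 = Store 16 12"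
  "layout_program ! 66 = Add 16 16 3"
  "layout_program ! 67 = Jump 46"
  "layout_program ! 68 = Add 13 12 12"
  "layout_program ! 69 = Load 14 13"
  "layout_program ! 70 = Add 13 13 3"
  "layout_program ! 71 = Load 15 13"
  "layout_program ! 72 = Store 9 12"
  "layout_program ! 73 = Add 9 9 3"
  "layout_program ! 74 = Add 18 18 3"
  "layout_program ! 75 = Div 17 17 19"
  "layout_program ! 76 = Store 10 15"
  "layout_program ! 77 = Add 10 10 3"
  "layout_program ! 78 = Store 10 18"
  "layout_program ! 79 = Add 10 10 3"
  "layout_program ! 80 = Store 10 17"
  "layout_program ! 81 = Add 10 10 3"
  "layout_program ! 82 = Store 10 14"
  "layout_program ! 83 = Add 10 10 3"
  "layout_program ! 84 = Store 10 18"
  "layout_program ! 85 = Add 10 10 3"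
  "layout_program ! 86 = Store 10 17"
  "layout_program ! 87 = Add 10 10 3"
  "layout_program ! 88 = Jump 46"
  "layout_program ! 89 = Sub 11 16 7"
  "layout_program ! 90 = JumpZero 11 102"
  "layout_program ! 91 = Sub 16 16 3"
  "layout_program ! 92 = Load 12 16"
  "layout_program ! 93 = Add 20 12 5"
  "layout_program ! 94 = Load 20 20"
  "layout_program ! 95 = Store 10 12"
  "layout_program ! 96 = Add 10 10 3"
  "layout_program ! 97 = Store 10 21"
  "layout_program ! 98 = Add 10 10 3"
  "layout_program ! 99 = Store 10 1"
  "layout_program ! 100 = Add 10 10 3"
  "layout_program ! 101 = Jump 46"
  "layout_program ! 102 = Move 0 6"
  by (simp_all add: layout_program_def)


section \<open>Single passes through the loops\<close>

lemma pop_null: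
  assumes "r 3 = 1" "r 8 = b" "b \<le> s" "r 10 = Suc (Suc (Suc s))" "m s = 0"
  shows "reaches layout_program M 9
    (\<lambda>n r' m'. n = 46 \<and> m' = m \<and> r' 10 = s \<and> (\<forall>i. i \<notin> {10, 11, 12, 17, 18} \<longrightarrow> r' i = r i)) 46 r m"
  using assms by (intro reaches_steps_to) (simp add: layout_program_nth)

text \<open>The machine compares by truncated subtraction:
  \<open>d * W\<^sup>2 - B * w\<^sup>2\<close> is 0 iff the node passes the weight test. The bounds
  by \<open>M\<close> cover the products formed on the way.\<close>

lemma pop_reject:
  assumes "r 3 = 1" "r 8 = b" "b \<le> s" "r 10 = Suc (Suc (Suc s))"
    and "m s = x" "m (Suc s) = d" "m (Suc (Suc s)) = 0" "x \<noteq> 0"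
    and "r 5 = c" "m (x + c) = w" "r 1 = B" "r 20 = W" "\<not> d * W\<^sup>2 \<le> B * w\<^sup>2" "r 16 = u"
    and "x + c \<le> M" "B * w\<^sup>2 \<le> M" "W\<^sup>2 \<le> M" "w\<^sup>2 \<le> M" "d * W\<^sup>2 \<le> M" "Suc u \<le> M"
  shows "reaches layout_program M 21
    (\<lambda>n r' m'. n = 46 \<and> m' = m(u := x) \<and> r' 10 = s \<and> r' 16 = Suc u \<and>
       (\<forall>i. i \<notin> {10, 11, 12, 13, 14, 16, 17, 18} \<longrightarrow> r' i = r i)) 46 r m"
  using assms by (intro reaches_steps_to) (simp add: layout_program_nth power2_eq_square mult_ac add_ac)


text \<open>39 is the length of the route through the weight test; for \<open>q > 0\<close> the test
  is skipped and 32 steps suffice. The right child is pushed before the left one, so the left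
  subtree is scanned first.\<close>

lemma pop_accept:
  assumes "r 3 = 1" "r 8 = b" "b \<le> s" "r 10 = Suc (Suc (Suc s))"
    and "m s = x" "m (Suc s) = d" "m (Suc (Suc s)) = q" "x \<noteq> 0"
    and "r 5 = c" "m (x + c) = w" "r 1 = B" "r 20 = W" "fits B W d q w" "r 9 = p" "r 19 = 2"
    and "m (x + x) = y" "m (Suc (x + x)) = z"
    and "x + c \<le> M" "B * w\<^sup>2 \<le> M" "W\<^sup>2 \<le> M" "w\<^sup>2 \<le> M" "d * W\<^sup>2 \<le> M" "Suc p \<le> M"
    and "Suc (x + x) \<le> M" "Suc d \<le> M" "Suc (Suc (Suc (Suc (Suc (Suc s))))) \<le> M"
  shows "reaches layout_program M 39
    (\<lambda>n r' m'. n = 46 \<and>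
       m' = m(p := x, s := z, Suc s := Suc d, Suc (Suc s) := q div 2,
              Suc (Suc (Suc s)) := y, Suc (Suc (Suc (Suc s))) := Suc d,
              Suc (Suc (Suc (Suc (Suc s)))) := q div 2) \<and>
       r' 10 = Suc (Suc (Suc (Suc (Suc (Suc s))))) \<and> r' 9 = Suc p \<and>
       (\<forall>i. i \<notin> {9, 10, 11, 12, 13, 14, 15, 17, 18} \<longrightarrow> r' i = r i)) 46 r m"
proof (cases "q = 0")
  case True
  then show ?thesis
    using assms
    by (intro reaches_steps_to)
       (simp add: layout_program_nth power2_eq_square mult_ac add_ac fits_def)
next
  case False
  then show ?thesis
    using assms
    by (intro reaches_mono_time[OF reaches_steps_to[of _ _ 32]])
       (simp_all add: layout_program_nth)
qed

lemma pop_group_root: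
  assumes "r 3 = 1" "r 8 = b" "r 10 = b" "r 7 = e" "e \<le> u" "r 16 = Suc u" "m u = x"
    and "r 5 = c" "m (x + c) = w" "r 21 = 0" "r 1 = B"
    and "x + c \<le> M" "Suc (Suc (Suc b)) \<le> M"
  shows "reaches layout_program M 15
    (\<lambda>n r' m'. n = 46 \<and> m' = m(b := x, Suc b := 0, Suc (Suc b) := B) \<and>
       r' 10 = Suc (Suc (Suc b)) \<and> r' 16 = u \<and> r' 20 = w \<and>
       (\<forall>i. i \<notin> {10, 11, 12, 16, 20} \<longrightarrow> r' i = r i)) 46 r m"
  using assms by (intro reaches_steps_to) (simp add: layout_program_nth add_ac)

lemma no_group_root:
  assumes "r 8 = b" "r 10 = b" "r 7 = e" "r 16 = e" "r 6 = a"
  shows "reaches layout_program M 5 (\<lambda>n r' m'. n = 103 \<and> m' = m \<and> r' 0 = a) 46 r m"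
  using assms by (intro reaches_steps_to) (simp add: layout_program_nth)

lemma preorder_pop_null:
  assumes "r 3 = 1" "r 8 = b" "b \<le> s" "r 10 = Suc s" "m s = 0"
  shows "reaches layout_program M 5
    (\<lambda>n r' m'. n = 9 \<and> m' = m \<and> r' 10 = s \<and> (\<forall>i. i \<notin> {10, 11, 12} \<longrightarrow> r' i = r i)) 9 r m"
  using assms by (intro reaches_steps_to) (simp add: layout_program_nth)

lemma preorder_pop_node:
  assumes "r 3 = 1" "r 8 = b" "b \<le> s" "r 10 = Suc s" "m s = x" "x \<noteq> 0" "r 9 = p"
    and "m (x + x) = y" "m (Suc (x + x)) = z"
    and "Suc p \<le> M" "Suc (x + x) \<le> M" "Suc (Suc s) \<le> M"
  shows "reaches layout_program M 16
    (\<lambda>n r' m'. n = 9 \<and> m' = m(p := x, s := z, Suc s := y) \<and> r' 10 = Suc (Suc s) \<and> r' 9 = Suc p \<and>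
       (\<forall>i. i \<notin> {9, 10, 11, 12, 13, 14, 15} \<longrightarrow> r' i = r i)) 9 r m"
  using assms by (intro reaches_steps_to) (simp add: layout_program_nth)

lemma preorder_end:
  assumes "r 8 = b" "r 10 = b"
  shows "reaches layout_program M 2
    (\<lambda>n r' m'. n = 25 \<and> m' = m \<and> (\<forall>i. i \<noteq> 11 \<longrightarrow> r' i = r i)) 9 r m"
  using assms by (intro reaches_steps_to) (simp add: layout_program_nth)

lemma sizes_node:
  assumes "r 3 = 1" "r 6 = a" "a \<le> p" "r 9 = Suc p" "m p = x" "r 5 = c"
    and "m (x + x) = y" "m (Suc (x + x)) = z" "m (y + c) = v" "m (z + c) = w"
    and "Suc (x + x) \<le> M" "x + c \<le> M" "y + c \<le> M" "z + c \<le> M" "Suc (v + w) \<le> M"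
  shows "reaches layout_program M 17
    (\<lambda>n r' m'. n = 25 \<and> m' = m(x + c := Suc (v + w)) \<and> r' 9 = p \<and>
       (\<forall>i. i \<notin> {9, 11, 12, 13, 14, 15} \<longrightarrow> r' i = r i)) 25 r m"
  using assms by (intro reaches_steps_to) (simp add: layout_program_nth)

lemma sizes_end:
  assumes "r 6 = a" "r 9 = a" "r 3 = 1" "r 7 = e" "r 2 = x" "Suc e \<le> M" "2 \<le> M"
  shows "reaches layout_program M 6
    (\<lambda>n r' m'. n = 46 \<and> m' = m(e := x) \<and> r' 16 = Suc e \<and> r' 19 = 2 \<and> r' 21 = 0 \<and>
       (\<forall>i. i \<notin> {11, 16, 19, 21} \<longrightarrow> r' i = r i)) 25 r m"
  using assms by (intro reaches_steps_to) (simp add: layout_program_nth)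

lemma initialize:
  assumes "r 0 = N" "r 2 = x" "5 * Suc N + 1 \<le> M"
  shows "reaches layout_program M 9
    (\<lambda>n r' m'. n = 9 \<and> m' = m(r' 8 := x) \<and> r' 1 = r 1 \<and> r' 2 = x \<and> r' 3 = 1 \<and>
       r' 5 = 2 * Suc N \<and> r' 6 = 3 * Suc N \<and> r' 7 = 4 * Suc N \<and> r' 8 = 5 * Suc N \<and>
       r' 9 = 3 * Suc N \<and> r' 10 = Suc (5 * Suc N)) 0 r m"
  using assms by (intro reaches_steps_to) (simp add: layout_program_nth flip: numeral_2_eq_2)

text \<open>The working stack holds at most \<open>N + 1\<close> entries of three cells from
  \<open>5 * Suc N\<close> on, which \<open>8 * N + 20\<close> covers with slack. The last two
  bounds are for the products in the weight test, whose depths and weights are at most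
  \<open>N\<close>.\<close>

locale layout_machine =
  fixes N B M :: nat
  assumes B: "B \<ge> 1" and M: "8 * N + 20 \<le> M" "B \<le> M" "B * N\<^sup>2 \<le> M" "N * N\<^sup>2 \<le> M"
begin

definition fixed_regs :: "(nat \<Rightarrow> nat) \<Rightarrow> bool" where
  "fixed_regs r \<longleftrightarrow> r 1 = B \<and> r 3 = 1 \<and> r 5 = 2 * Suc N \<and> r 6 = 3 * Suc N \<and> r 7 = 4 * Suc N \<and>
     r 8 = 5 * Suc N \<and> r 19 = 2 \<and> r 21 = 0"

text \<open>\<open>g\<close> is what is appended to the output at \<open>p\<close>, and
  \<open>e\<close> what is pushed onto the stack of pending groups at \<open>u\<close>. Nothing is
  said about the cells from \<open>s\<close> on, the discarded part of the working stack.\<close>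

definition scan_post ::
    "(nat \<Rightarrow> nat) \<Rightarrow> nat \<Rightarrow> nat \<Rightarrow> nat \<Rightarrow> nat \<Rightarrow> nat list \<Rightarrow> nat list
     \<Rightarrow> nat \<Rightarrow> (nat \<Rightarrow> nat) \<Rightarrow> (nat \<Rightarrow> nat) \<Rightarrow> bool" where
  "scan_post m W s p u g e n r' m' \<longleftrightarrow> n = 46 \<and> fixed_regs r' \<and> r' 20 = W \<and> r' 10 = s \<and>
     r' 9 = p + length g \<and> r' 16 = u + length e \<and> holds m' p g \<and> holds m' u e \<and>
     (\<forall>a<s. \<not> (p \<le> a \<and> a < p + length g) \<longrightarrow> \<not> (u \<le> a \<and> a < u + length e) \<longrightarrow> m' a = m a)"

lemma fits_bounds:
  assumes "w \<le> N" "W \<le> N" "d \<le> N"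
  shows "B * w\<^sup>2 \<le> M" "W\<^sup>2 \<le> M" "w\<^sup>2 \<le> M" "d * W\<^sup>2 \<le> M"
proof -
  have sq: "w\<^sup>2 \<le> N\<^sup>2" "W\<^sup>2 \<le> N\<^sup>2"
    using assms by (simp_all add: power_mono)
  then show "B * w\<^sup>2 \<le> M" "d * W\<^sup>2 \<le> M"
    using M(3,4) assms by (meson le_trans mult_le_mono order_refl)+
  have "N\<^sup>2 \<le> B * N\<^sup>2"
    using B by (cases B) auto
  then show "W\<^sup>2 \<le> M" "w\<^sup>2 \<le> M"
    using sq M(3) by linarith+
qed

lemma scan_group:
  assumes "linked m0 t" "sized m0 (2 * Suc N) t" "set_tree t \<subseteq> {1..N}"
    and "\<And>a. a < 3 * Suc N \<Longrightarrow> m a = m0 a"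
    and "W \<le> N" "d + size t \<le> N"
    and "fixed_regs r" "r 20 = W" "r 10 = Suc (Suc (Suc s))" "r 9 = p" "r 16 = u"
    and "holds m s [root_name t, d, q]"
    and "3 * Suc N \<le> p" "p + length (group_nodes B W d q t) \<le> 4 * Suc N"
    and "4 * Suc N \<le> u" "u + length (group_exits B W d q t) \<le> 5 * Suc N"
    and "5 * Suc N \<le> s" "s + 3 * size t + 3 \<le> M"
  shows "reaches layout_program M (40 * (2 * length (group_nodes B W d q t) + 1))
    (scan_post m W s p u (group_nodes B W d q t) (rev (map root_name (group_exits B W d q t)))) 46 r m"
  using assms
proof (induction t arbitrary: d q s p u r m)
  case Leaf
  show ?case
    by (rule reaches_mono, rule pop_null[of r "5 * Suc N" s m])
       (use Leaf.prems in \<open>simp_all add: fixed_regs_def scan_post_def\<close>)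
next
  case (Node l x t')
  let ?t = "Node l x t'"
  note fixed = Node.prems(7)[unfolded fixed_regs_def]
  have stack: "m s = x" "m (Suc s) = d" "m (Suc (Suc s)) = q"
    using Node.prems(12) by simp_all
  have x: "x \<noteq> 0" "x \<le> N"
    using Node.prems(3) by auto
  have children: "m (x + x) = root_name l" "m (Suc (x + x)) = root_name t'"
    using Node.prems(1) Node.prems(4)[of "x + x"] Node.prems(4)[of "Suc (x + x)"] x(2)
    by (simp_all flip: mult_2)
  have weight: "m (x + 2 * Suc N) = size ?t"
    using Node.prems(2) Node.prems(4)[of "x + 2 * Suc N"] x(2) by (simp add: add.commute)
  have small: "size ?t \<le> N" "W \<le> N" "d \<le> N"
    using Node.prems(5,6) by auto
  note squares = fits_bounds[OF small]
  show ?case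
  proof (cases "fits B W d q (size ?t)")
    case False
    then have "q = 0" "\<not> d * W\<^sup>2 \<le> B * (size ?t)\<^sup>2"
      by (auto simp: fits_def)
    then have "reaches layout_program M 21
       (\<lambda>n r' m'. n = 46 \<and> m' = m(u := x) \<and> r' 10 = s \<and> r' 16 = Suc u \<and>
          (\<forall>i. i \<notin> {10, 11, 12, 13, 14, 16, 17, 18} \<longrightarrow> r' i = r i)) 46 r m"
      using Node.prems(8-18) fixed stack x weight squares
      by (intro pop_reject[where b = "5 * Suc N" and c = "2 * Suc N" and d = d and B = B and W = W
            and w = "size ?t"]) (simp_all del: tree.size)
    then show ?thesis
      using False Node.prems(7-11)
      by (elim reaches_mono) (auto simp: scan_post_def fixed_regs_def)
  next
    case True
    define gl gr el er where
      "gl = group_nodes B W (Suc d) (q div 2) l" and "gr = group_nodes B W (Suc d) (q div 2) t'" and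
      "el = group_exits B W (Suc d) (q div 2) l" and "er = group_exits B W (Suc d) (q div 2) t'"
    have g: "group_nodes B W d q ?t = x # gl @ gr" and e: "group_exits B W d q ?t = er @ el"
      using True by (simp_all add: gl_def gr_def el_def er_def)
    have space: "p + Suc (length gl + length gr) \<le> 4 * Suc N" "u + (length el + length er) \<le> 5 * Suc N"
      using Node.prems(14,16) unfolding g e by simp_all
    have height: "s + 3 * size l + 6 \<le> M" "s + 3 * size t' + 6 \<le> M"
      using Node.prems(18) by simp_all
    have top: "Suc (Suc (Suc (Suc (Suc (Suc s))))) \<le> M"
      using height by simp
    have "reaches layout_program M 39
      (\<lambda>n r' m'. n = 46 \<and>
       m' = m(p := x, s := root_name t', Suc s := Suc d, Suc (Suc s) := q div 2,
              Suc (Suc (Suc s)) := root_name l, Suc (Suc (Suc (Suc s))) := Suc d,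
              Suc (Suc (Suc (Suc (Suc s)))) := q div 2) \<and>
       r' 10 = Suc (Suc (Suc (Suc (Suc (Suc s))))) \<and> r' 9 = Suc p \<and>
       (\<forall>i. i \<notin> {9, 10, 11, 12, 13, 14, 15, 17, 18} \<longrightarrow> r' i = r i)) 46 r m"
      using Node.prems(8-18) fixed stack x weight squares children True small M(1) top
      by (intro pop_accept[where b = "5 * Suc N" and c = "2 * Suc N" and d = d and q = q and B = B
            and W = W and w = "size ?t"]) (simp_all del: tree.size(4))
    then show ?thesis
    proof (rule reaches_trans, elim conjE)
      fix n1 :: nat and r1 m1 :: "nat \<Rightarrow> nat"
      assume n1: "n1 = 46" and
        m1: "m1 = m(p := x, s := root_name t', Suc s := Suc d, Suc (Suc s) := q div 2,
              Suc (Suc (Suc s)) := root_name l, Suc (Suc (Suc (Suc s))) := Suc d,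
              Suc (Suc (Suc (Suc (Suc s)))) := q div 2)" and
        r1: "r1 10 = Suc (Suc (Suc (Suc (Suc (Suc s)))))" "r1 9 = Suc p"
          "\<forall>i. i \<notin> {9, 10, 11, 12, 13, 14, 15, 17, 18} \<longrightarrow> r1 i = r i"
      have "reaches layout_program M (40 * (2 * length gl + 1))
          (scan_post m1 W (Suc (Suc (Suc s))) (Suc p) u gl (rev (map root_name el))) 46 r1 m1"
        unfolding gl_def el_def
      proof (rule Node.IH(1))
        show "fixed_regs r1"
          using r1(3) fixed by (simp add: fixed_regs_def)
        show "m1 a = m0 a" if "a < 3 * Suc N" for a
          using that Node.prems(4)[OF that] Node.prems(13,17) by (simp add: m1)
        show "holds m1 (Suc (Suc (Suc s))) [root_name l, Suc d, q div 2]"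
          by (simp add: m1)
      qed (use Node.prems space height r1 in \<open>auto simp: gl_def el_def\<close>)
      then show "reaches layout_program M (40 * (2 * length gl + 1) + 40 * (2 * length gr + 1))
         (scan_post m W s p u (group_nodes B W d q ?t) (rev (map root_name (group_exits B W d q ?t)))) n1 r1 m1"
        unfolding n1
      proof (rule reaches_trans)
        fix n2 r2 m2
        assume "scan_post m1 W (Suc (Suc (Suc s))) (Suc p) u gl (rev (map root_name el)) n2 r2 m2"
        then have n2: "n2 = 46" and r2: "fixed_regs r2" "r2 20 = W" "r2 10 = Suc (Suc (Suc s))"
            "r2 9 = Suc p + length gl" "r2 16 = u + length el" and
          m2: "holds m2 (Suc p) gl" "holds m2 u (rev (map root_name el))"
            "\<And>a. a < Suc (Suc (Suc s)) \<Longrightarrow> \<not> (Suc p \<le> a \<and> a < Suc p + length gl) \<Longrightarrow>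
               \<not> (u \<le> a \<and> a < u + length el) \<Longrightarrow> m2 a = m1 a"
          by (auto simp: scan_post_def)
        have "reaches layout_program M (40 * (2 * length gr + 1))
          (scan_post m2 W s (Suc p + length gl) (u + length el) gr (rev (map root_name er))) 46 r2 m2"
          unfolding gr_def er_def
        proof (rule Node.IH(2))
          show "m2 a = m0 a" if "a < 3 * Suc N" for a
            using that Node.prems(4)[OF that] Node.prems(13,15,17) m2(3)[of a] by (simp add: m1)
          \<comment> \<open>The entry of the right child lies just below the stack segment used by
            the left scan and beyond the regions it appends to, so it is still intact.\<close>
          have "m2 a = m1 a" if "s \<le> a" "a < Suc (Suc (Suc s))" for a
            using that space Node.prems(17) by (intro m2(3)) auto
          then show "holds m2 s [root_name t', Suc d, q div 2]"
            by (simp add: m1)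
        qed (use Node.prems space height r2 in \<open>auto simp: gr_def er_def\<close>)
        then show "reaches layout_program M (40 * (2 * length gr + 1))
          (scan_post m W s p u (group_nodes B W d q ?t) (rev (map root_name (group_exits B W d q ?t)))) n2 r2 m2"
          unfolding n2
        proof (rule reaches_mono)
          fix n3 r3 m3
          assume "scan_post m2 W s (Suc p + length gl) (u + length el) gr (rev (map root_name er)) n3 r3 m3"
          then have n3: "n3 = 46" and r3: "fixed_regs r3" "r3 20 = W" "r3 10 = s"
              "r3 9 = Suc p + length gl + length gr" "r3 16 = u + length el + length er" and
            m3: "holds m3 (Suc p + length gl) gr" "holds m3 (u + length el) (rev (map root_name er))"
              "\<And>a. a < s \<Longrightarrow> \<not> (Suc p + length gl \<le> a \<and> a < Suc p + length gl + length gr) \<Longrightarrow>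
                 \<not> (u + length el \<le> a \<and> a < u + length el + length er) \<Longrightarrow> m3 a = m2 a"
            by (auto simp: scan_post_def)
          have "holds m3 (Suc p) gl"
            using m2(1) by (rule holds_cong) (use space Node.prems(15,17) in \<open>intro m3(3); simp\<close>)
          moreover have "holds m3 u (rev (map root_name el))"
            using m2(2) by (rule holds_cong) (use space Node.prems(15,17) in \<open>intro m3(3); simp\<close>)
          moreover have "m3 p = x"
            using m3(3)[of p] m2(3)[of p] space Node.prems(15,17) by (simp add: m1)
          moreover have "m3 a = m a" if "a < s" "\<not> (p \<le> a \<and> a < p + Suc (length gl + length gr))"
            "\<not> (u \<le> a \<and> a < u + (length el + length er))" for a
            using m3(3)[of a] m2(3)[of a] that by (auto simp: m1)
          ultimately show "scan_post m W s p u (group_nodes B W d q ?t)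
              (rev (map root_name (group_exits B W d q ?t))) n3 r3 m3"
            using n3 r3 m3(1,2) unfolding g e by (auto simp: scan_post_def)
        qed simp
      qed simp
    qed (unfold g, simp)
  qed
qed

end

lemma sized_cong:
  "sized m a t \<Longrightarrow> (\<And>x. x \<in> set_tree t \<Longrightarrow> m' (a + x) = m (a + x)) \<Longrightarrow> sized m' a t"
  by (induction t) auto

lemma linked_exits: "linked m t \<Longrightarrow> u \<in> set (group_exits B' W d q t) \<Longrightarrow> linked m u"
  by (induction B' W d q t rule: group_exits.induct) (auto split: if_splits)

lemma sized_exits: "sized m a t \<Longrightarrow> u \<in> set (group_exits B' W d q t) \<Longrightarrow> sized m a u"
  by (induction B' W d q t rule: group_exits.induct) (auto split: if_splits)

lemma set_tree_exits: "u \<in> set (group_exits B' W d q t) \<Longrightarrow> set_tree u \<subseteq> set_tree t"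
  by (induction B' W d q t rule: group_exits.induct) (auto split: if_splits)

text \<open>This keeps the stack of pending groups within its region: pending trees are nonempty,
  and their sizes add up to at most \<open>N\<close>.\<close>

lemma length_le_sum_sizes: "Leaf \<notin> set ts \<Longrightarrow> length ts \<le> (\<Sum>t\<leftarrow>ts. size t)"
proof (induction ts)
  case (Cons t ts)
  then show ?case by (cases t) auto
qed simp

text \<open>Node names start at 1, so the cell at \<open>a\<close> belongs to no node; holding 0, it
  serves as the size of an absent child and spares the machine a test for the null pointer.\<close>

lemma size_root: "sized m a t \<Longrightarrow> m a = 0 \<Longrightarrow> m (root_name t + a) = size t"
  by (cases t) (auto simp: add.commute)

lemma tree_layout_Cons:
  "t \<noteq> Leaf \<Longrightarrow> tree_layout B (t # ts) = group B t @ tree_layout B (exits B t @ ts)"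
  by (simp add: tree_layout_def)

context layout_machine
begin

text \<open>Each group is charged to its own nodes: popping its root and scanning a group of
  \<open>g \<ge> 1\<close> nodes takes at most \<open>15 + 40 * (2 * g + 1) \<le> 135 * g\<close>
  steps, and the total pending size, on which the induction runs, drops by exactly
  \<open>g\<close>.\<close>

lemma scan_groups:
  assumes "Leaf \<notin> set ts"
    and "\<And>t. t \<in> set ts \<Longrightarrow> linked m0 t \<and> sized m0 (2 * Suc N) t \<and> set_tree t \<subseteq> {1..N}"
    and "\<And>a. a < 3 * Suc N \<Longrightarrow> m a = m0 a"
    and "fixed_regs r" "r 10 = 5 * Suc N" "r 9 = p" "r 16 = 4 * Suc N + length ts"
    and "holds m (4 * Suc N) (rev (map root_name ts))"
    and "3 * Suc N \<le> p" "p + (\<Sum>t\<leftarrow>ts. size t) \<le> 4 * Suc N"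
    and "(\<Sum>t\<leftarrow>ts. size t) \<le> N"
  shows "reaches layout_program M (135 * (\<Sum>t\<leftarrow>ts. size t) + 5)
    (\<lambda>n r' m'. n = 103 \<and> r' 0 = 3 * Suc N \<and> holds m' p (tree_layout B ts) \<and>
       (\<forall>a. 3 * Suc N \<le> a \<longrightarrow> a < p \<longrightarrow> m' a = m a)) 46 r m"
  using assms
proof (induction "\<Sum>t\<leftarrow>ts. size t" arbitrary: ts r m p rule: less_induct)
  case less
  show ?case
  proof (cases ts)
    case Nil
    show ?thesis
      by (rule reaches_mono, rule no_group_root[of r "5 * Suc N" "4 * Suc N" "3 * Suc N"])
         (use less.prems Nil in \<open>simp_all add: fixed_regs_def tree_layout_def\<close>)
  next
    case (Cons t ts')
    note prems = less.prems[unfolded Cons]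
    let ?g = "group B t" and ?e = "exits B t"
    let ?u = "4 * Suc N + length ts'"
    note fixed = prems(4)[unfolded fixed_regs_def]
    have t: "t \<noteq> Leaf" "linked m0 t" "sized m0 (2 * Suc N) t" "set_tree t \<subseteq> {1..N}"
      using prems(1,2) by auto
    obtain l x t' where "t = Node l x t'"
      using t(1) by (cases t) auto
    then have root: "root_name t \<in> {1..N}"
      using t(4) by auto
    have size_t: "size t = length ?g + (\<Sum>u\<leftarrow>?e. size u)"
      by (rule group_partition_size)
    have "?g \<noteq> []"
      using t(1) by (cases t) auto
    then have g: "length ?g \<ge> 1"
      by (cases ?g) auto
    have "length ?e \<le> (\<Sum>u\<leftarrow>?e. size u)" "length ts' \<le> (\<Sum>u\<leftarrow>ts'. size u)"
      using prems(1) by (auto intro!: length_le_sum_sizes simp: Leaf_notin_exits)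
    moreover have total: "size t + (\<Sum>u\<leftarrow>ts'. size u) \<le> N" "p + (size t + (\<Sum>u\<leftarrow>ts'. size u)) \<le> 4 * Suc N"
      using prems(10,11) by simp_all
    ultimately have room: "?u + length ?e \<le> 5 * Suc N" "p + length ?g \<le> 4 * Suc N"
      using size_t by simp_all
    have "m ?u = root_name t" and stack: "holds m (4 * Suc N) (rev (map root_name ts'))"
      using prems(8) by simp_all
    moreover have "m (root_name t + 2 * Suc N) = size t"
      using prems(3)[of "root_name t + 2 * Suc N"] t(3) root \<open>t = Node l x t'\<close> by (simp add: add.commute)
    ultimately have "reaches layout_program M 15
      (\<lambda>n r' m'. n = 46 \<and> m' = m(5 * Suc N := root_name t, Suc (5 * Suc N) := 0, Suc (Suc (5 * Suc N)) := B) \<and>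
         r' 10 = Suc (Suc (Suc (5 * Suc N))) \<and> r' 16 = ?u \<and> r' 20 = size t \<and>
         (\<forall>i. i \<notin> {10, 11, 12, 16, 20} \<longrightarrow> r' i = r i)) 46 r m"
      using fixed prems(5,7) M(1) root
      by (intro pop_group_root[where e = "4 * Suc N" and c = "2 * Suc N"]) auto
    then show ?thesis
      unfolding Cons
    proof (rule reaches_trans, elim conjE)
      fix n1 :: nat and r1 m1 :: "nat \<Rightarrow> nat"
      assume n1: "n1 = 46" and
        m1: "m1 = m(5 * Suc N := root_name t, Suc (5 * Suc N) := 0, Suc (Suc (5 * Suc N)) := B)" and
        r1: "r1 10 = Suc (Suc (Suc (5 * Suc N)))" "r1 16 = ?u" "r1 20 = size t"
          "\<forall>i. i \<notin> {10, 11, 12, 16, 20} \<longrightarrow> r1 i = r i"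
      have m1_eq: "m1 a = m a" if "a < 5 * Suc N" for a
        using that by (simp add: m1)
      have "reaches layout_program M (40 * (2 * length ?g + 1))
          (scan_post m1 (size t) (5 * Suc N) p ?u ?g (rev (map root_name ?e))) 46 r1 m1"
      proof (rule scan_group)
        show "m1 a = m0 a" if "a < 3 * Suc N" for a
          using m1_eq[of a] prems(3)[OF that] that by simp
        show "fixed_regs r1"
          using fixed r1(4) by (simp add: fixed_regs_def)
        show "r1 9 = p"
          using r1(4) prems(6) by simp
        show "holds m1 (5 * Suc N) [root_name t, 0, B]"
          by (simp add: m1)
        show "5 * Suc N + 3 * size t + 3 \<le> M"
          using total M(1) by simp
      qed (use t r1 room prems(9) total in simp_all)
      then show "reaches layout_program M (40 * (2 * length ?g + 1) + (135 * (\<Sum>u\<leftarrow>?e @ ts'. size u) + 5))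
        (\<lambda>n r' m'. n = 103 \<and> r' 0 = 3 * Suc N \<and> holds m' p (tree_layout B (t # ts')) \<and>
           (\<forall>a. 3 * Suc N \<le> a \<longrightarrow> a < p \<longrightarrow> m' a = m a)) n1 r1 m1"
        unfolding n1
      proof (rule reaches_trans)
        fix n2 :: nat and r2 m2 :: "nat \<Rightarrow> nat"
        assume "scan_post m1 (size t) (5 * Suc N) p ?u ?g (rev (map root_name ?e)) n2 r2 m2"
        then have n2: "n2 = 46" and r2: "fixed_regs r2" "r2 10 = 5 * Suc N" "r2 9 = p + length ?g"
            "r2 16 = ?u + length ?e" and
          m2: "holds m2 p ?g" "holds m2 ?u (rev (map root_name ?e))"
            "\<And>a. a < 5 * Suc N \<Longrightarrow> \<not> (p \<le> a \<and> a < p + length ?g) \<Longrightarrow>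
               \<not> (?u \<le> a \<and> a < ?u + length ?e) \<Longrightarrow> m2 a = m1 a"
          by (auto simp: scan_post_def)
        have m2_eq: "m2 a = m a" if "a < ?u" "\<not> (p \<le> a \<and> a < p + length ?g)" for a
          using that m2(3)[of a] m1_eq[of a] room by simp
        have "reaches layout_program M (135 * (\<Sum>u\<leftarrow>?e @ ts'. size u) + 5)
          (\<lambda>n r' m'. n = 103 \<and> r' 0 = 3 * Suc N \<and> holds m' (p + length ?g) (tree_layout B (?e @ ts')) \<and>
             (\<forall>a. 3 * Suc N \<le> a \<longrightarrow> a < p + length ?g \<longrightarrow> m' a = m2 a)) 46 r2 m2"
        proof (rule less.hyps)
          show "(\<Sum>u\<leftarrow>?e @ ts'. size u) < (\<Sum>u\<leftarrow>ts. size u)"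
            using g size_t by (simp add: Cons)
          show "Leaf \<notin> set (?e @ ts')"
            using prems(1) by (simp add: Leaf_notin_exits)
          show "linked m0 u \<and> sized m0 (2 * Suc N) u \<and> set_tree u \<subseteq> {1..N}" if "u \<in> set (?e @ ts')" for u
            using that prems(2)[of u] t linked_exits[OF t(2)] sized_exits[OF t(3)] set_tree_exits[of u]
            by fastforce
          show "m2 a = m0 a" if "a < 3 * Suc N" for a
            using that prems(3)[OF that] prems(9) by (simp add: m2_eq)
          have "holds m2 (4 * Suc N) (rev (map root_name ts'))"
            using stack by (rule holds_cong) (use room in \<open>intro m2_eq; simp\<close>)
          then show "holds m2 (4 * Suc N) (rev (map root_name (?e @ ts')))"
            using m2(2) by simp
        qed (use r2 prems(9) total size_t in simp_all)
        then show "reaches layout_program M (135 * (\<Sum>u\<leftarrow>?e @ ts'. size u) + 5)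
          (\<lambda>n r' m'. n = 103 \<and> r' 0 = 3 * Suc N \<and> holds m' p (tree_layout B (t # ts')) \<and>
             (\<forall>a. 3 * Suc N \<le> a \<longrightarrow> a < p \<longrightarrow> m' a = m a)) n2 r2 m2"
          unfolding n2
        proof (rule reaches_mono, elim conjE)
          fix n3 :: nat and r3 m3 :: "nat \<Rightarrow> nat"
          assume 3: "n3 = 103" "r3 0 = 3 * Suc N" "holds m3 (p + length ?g) (tree_layout B (?e @ ts'))"
            "\<forall>a. 3 * Suc N \<le> a \<longrightarrow> a < p + length ?g \<longrightarrow> m3 a = m2 a"
          have "holds m3 p ?g"
            using m2(1) by (rule holds_cong) (use 3(4) prems(9) in simp)
          moreover have "m3 a = m a" if "3 * Suc N \<le> a" "a < p" for a
            using that 3(4) m2_eq[of a] room by simp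
          ultimately show "n3 = 103 \<and> r3 0 = 3 * Suc N \<and> holds m3 p (tree_layout B (t # ts')) \<and>
             (\<forall>a. 3 * Suc N \<le> a \<longrightarrow> a < p \<longrightarrow> m3 a = m a)"
            using 3(1-3) by (simp add: tree_layout_Cons[OF t(1)])
        qed simp
      qed simp
    qed (use g size_t in simp)
  qed
qed

text \<open>There are \<open>size t\<close> passes of 16 steps for nodes and
  \<open>size t + 1\<close> passes of 5 steps for null pointers, whence
  \<open>21 * size t + 5\<close>.\<close>

lemma list_preorder:
  assumes "linked m0 t" "set_tree t \<subseteq> {1..N}"
    and "\<And>a. a < 3 * Suc N \<Longrightarrow> m a = m0 a"
    and "r 3 = 1" "r 8 = 5 * Suc N" "r 10 = Suc s" "r 9 = p" "m s = root_name t"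
    and "3 * Suc N \<le> p" "p + size t \<le> 5 * Suc N" "5 * Suc N \<le> s" "s + size t + 1 \<le> M"
  shows "reaches layout_program M (21 * size t + 5)
    (\<lambda>n r' m'. n = 9 \<and> r' 10 = s \<and> r' 9 = p + size t \<and>
       (\<forall>i. i \<notin> {9, 10, 11, 12, 13, 14, 15} \<longrightarrow> r' i = r i) \<and> holds m' p (preorder t) \<and>
       (\<forall>a<s. \<not> (p \<le> a \<and> a < p + size t) \<longrightarrow> m' a = m a)) 9 r m"
  using assms
proof (induction t arbitrary: s p r m)
  case Leaf
  show ?case
    by (rule reaches_mono, rule preorder_pop_null[of r "5 * Suc N" s m]) (use Leaf.prems in simp_all)
next
  case (Node l x t')
  let ?t = "Node l x t'"
  have x: "x \<noteq> 0" "x \<le> N"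
    using Node.prems(2) by auto
  have "m (x + x) = root_name l" "m (Suc (x + x)) = root_name t'"
    using Node.prems(1) Node.prems(3)[of "x + x"] Node.prems(3)[of "Suc (x + x)"] x(2)
    by (simp_all flip: mult_2)
  then have "reaches layout_program M 16
    (\<lambda>n r' m'. n = 9 \<and> m' = m(p := x, s := root_name t', Suc s := root_name l) \<and>
       r' 10 = Suc (Suc s) \<and> r' 9 = Suc p \<and>
       (\<forall>i. i \<notin> {9, 10, 11, 12, 13, 14, 15} \<longrightarrow> r' i = r i)) 9 r m"
    using Node.prems(4-12) x M(1) by (intro preorder_pop_node[where b = "5 * Suc N"]) simp_all
  then show ?case
  proof (rule reaches_trans, elim conjE)
    fix n1 :: nat and r1 m1 :: "nat \<Rightarrow> nat"
    assume n1: "n1 = 9" and m1: "m1 = m(p := x, s := root_name t', Suc s := root_name l)" and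
      r1: "r1 10 = Suc (Suc s)" "r1 9 = Suc p"
        "\<forall>i. i \<notin> {9, 10, 11, 12, 13, 14, 15} \<longrightarrow> r1 i = r i"
    have "reaches layout_program M (21 * size l + 5)
      (\<lambda>n r' m'. n = 9 \<and> r' 10 = Suc s \<and> r' 9 = Suc p + size l \<and>
         (\<forall>i. i \<notin> {9, 10, 11, 12, 13, 14, 15} \<longrightarrow> r' i = r1 i) \<and> holds m' (Suc p) (preorder l) \<and>
         (\<forall>a<Suc s. \<not> (Suc p \<le> a \<and> a < Suc p + size l) \<longrightarrow> m' a = m1 a)) 9 r1 m1"
    proof (rule Node.IH(1))
      show "m1 a = m0 a" if "a < 3 * Suc N" for a
        using that Node.prems(3)[OF that] Node.prems(9,11) by (simp add: m1)
    qed (use Node.prems r1 m1 in auto)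
    then show "reaches layout_program M (21 * size l + 5 + (21 * size t' + 5))
      (\<lambda>n r' m'. n = 9 \<and> r' 10 = s \<and> r' 9 = p + size ?t \<and>
         (\<forall>i. i \<notin> {9, 10, 11, 12, 13, 14, 15} \<longrightarrow> r' i = r i) \<and> holds m' p (preorder ?t) \<and>
         (\<forall>a<s. \<not> (p \<le> a \<and> a < p + size ?t) \<longrightarrow> m' a = m a)) n1 r1 m1"
      unfolding n1
    proof (rule reaches_trans, elim conjE)
      fix n2 :: nat and r2 m2 :: "nat \<Rightarrow> nat"
      assume n2: "n2 = 9" and r2: "r2 10 = Suc s" "r2 9 = Suc p + size l"
          "\<forall>i. i \<notin> {9, 10, 11, 12, 13, 14, 15} \<longrightarrow> r2 i = r1 i" and
        m2: "holds m2 (Suc p) (preorder l)"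
          "\<forall>a<Suc s. \<not> (Suc p \<le> a \<and> a < Suc p + size l) \<longrightarrow> m2 a = m1 a"
      have "reaches layout_program M (21 * size t' + 5)
        (\<lambda>n r' m'. n = 9 \<and> r' 10 = s \<and> r' 9 = Suc p + size l + size t' \<and>
           (\<forall>i. i \<notin> {9, 10, 11, 12, 13, 14, 15} \<longrightarrow> r' i = r2 i) \<and>
           holds m' (Suc p + size l) (preorder t') \<and>
           (\<forall>a<s. \<not> (Suc p + size l \<le> a \<and> a < Suc p + size l + size t') \<longrightarrow> m' a = m2 a)) 9 r2 m2"
      proof (rule Node.IH(2))
        show "m2 a = m0 a" if "a < 3 * Suc N" for a
          using that Node.prems(3)[OF that] Node.prems(9,11) m2(2) by (simp add: m1)
        show "m2 s = root_name t'"
          using m2(2) Node.prems(10,11) by (simp add: m1)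
      qed (use Node.prems r1 r2 in auto)
      then show "reaches layout_program M (21 * size t' + 5)
        (\<lambda>n r' m'. n = 9 \<and> r' 10 = s \<and> r' 9 = p + size ?t \<and>
           (\<forall>i. i \<notin> {9, 10, 11, 12, 13, 14, 15} \<longrightarrow> r' i = r i) \<and> holds m' p (preorder ?t) \<and>
           (\<forall>a<s. \<not> (p \<le> a \<and> a < p + size ?t) \<longrightarrow> m' a = m a)) n2 r2 m2"
        unfolding n2
      proof (rule reaches_mono, elim conjE)
        fix n3 :: nat and r3 m3 :: "nat \<Rightarrow> nat"
        assume 3: "n3 = 9" "r3 10 = s" "r3 9 = Suc p + size l + size t'"
          "\<forall>i. i \<notin> {9, 10, 11, 12, 13, 14, 15} \<longrightarrow> r3 i = r2 i"
          "holds m3 (Suc p + size l) (preorder t')"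
          "\<forall>a<s. \<not> (Suc p + size l \<le> a \<and> a < Suc p + size l + size t') \<longrightarrow> m3 a = m2 a"
        have "holds m3 (Suc p) (preorder l)"
          using m2(1) by (rule holds_cong) (use 3(6) Node.prems(10,11) in simp)
        moreover have "m3 p = x"
          using 3(6) m2(2) Node.prems(10,11) by (simp add: m1)
        moreover have "m3 a = m a" if "a < s" "\<not> (p \<le> a \<and> a < p + size ?t)" for a
          using 3(6) m2(2) that by (auto simp: m1)
        ultimately show "n3 = 9 \<and> r3 10 = s \<and> r3 9 = p + size ?t \<and>
           (\<forall>i. i \<notin> {9, 10, 11, 12, 13, 14, 15} \<longrightarrow> r3 i = r i) \<and> holds m3 p (preorder ?t) \<and>
           (\<forall>a<s. \<not> (p \<le> a \<and> a < p + size ?t) \<longrightarrow> m3 a = m a)"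
          using 3(1-5) r1(3) r2(3) by simp
      qed simp
    qed simp
  qed simp
qed

text \<open>Read backwards, a preorder lists the right subtree, then the left one, then the root, so
  both child sizes are known when a node is reached; the induction hypotheses are applied in this
  order. \<open>m0 (2 * Suc N) = 0\<close> supplies the size of an absent child.\<close>

lemma compute_sizes:
  assumes "linked m0 t" "set_tree t \<subseteq> {1..N}" "distinct (inorder t)" "size t \<le> N"
    and "\<And>a. a \<le> 2 * Suc N \<Longrightarrow> m a = m0 a" "m0 (2 * Suc N) = 0"
    and "r 3 = 1" "r 5 = 2 * Suc N" "r 6 = 3 * Suc N" "r 9 = p + size t"
    and "holds m p (preorder t)" "3 * Suc N \<le> p"
  shows "reaches layout_program M (17 * size t)
    (\<lambda>n r' m'. n = 25 \<and> r' 9 = p \<and>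
       (\<forall>i. i \<notin> {9, 11, 12, 13, 14, 15} \<longrightarrow> r' i = r i) \<and> sized m' (2 * Suc N) t \<and>
       (\<forall>a. a \<notin> (+) (2 * Suc N) ` set_tree t \<longrightarrow> m' a = m a)) 25 r m"
  using assms
proof (induction t arbitrary: p r m)
  case Leaf
  then show ?case by (intro reaches_refl) simp
next
  case (Node l x t')
  let ?t = "Node l x t'" and ?w = "2 * Suc N"
  have x: "x \<noteq> 0" "x \<le> N"
    using Node.prems(2) by auto
  have names: "set_tree l \<subseteq> {1..N}" "set_tree t' \<subseteq> {1..N}" "x \<notin> set_tree l" "x \<notin> set_tree t'"
      "set_tree l \<inter> set_tree t' = {}"
    using Node.prems(2,3) by auto
  have roots: "root_name l \<le> N" "root_name t' \<le> N"
    using names by (cases l; auto) (use names in \<open>cases t'; auto\<close>)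
  have low: "a \<notin> (+) ?w ` A" if "a \<le> ?w" "A \<subseteq> {1..N}" for a A
    using that by fastforce
  have high: "a \<notin> (+) ?w ` A" if "3 * Suc N \<le> a" "A \<subseteq> {1..N}" for a A
    using that by fastforce
  have "reaches layout_program M (17 * size t')
    (\<lambda>n r' m'. n = 25 \<and> r' 9 = Suc p + size l \<and>
       (\<forall>i. i \<notin> {9, 11, 12, 13, 14, 15} \<longrightarrow> r' i = r i) \<and> sized m' ?w t' \<and>
       (\<forall>a. a \<notin> (+) ?w ` set_tree t' \<longrightarrow> m' a = m a)) 25 r m"
    by (rule Node.IH(2)) (use Node.prems in auto)
  then show ?case
  proof (rule reaches_trans, elim conjE)
    fix n1 :: nat and r1 m1 :: "nat \<Rightarrow> nat"
    assume n1: "n1 = 25" and r1: "r1 9 = Suc p + size l"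
        "\<forall>i. i \<notin> {9, 11, 12, 13, 14, 15} \<longrightarrow> r1 i = r i" and
      m1: "sized m1 ?w t'" "\<forall>a. a \<notin> (+) ?w ` set_tree t' \<longrightarrow> m1 a = m a"
    have "reaches layout_program M (17 * size l)
      (\<lambda>n r' m'. n = 25 \<and> r' 9 = Suc p \<and>
         (\<forall>i. i \<notin> {9, 11, 12, 13, 14, 15} \<longrightarrow> r' i = r1 i) \<and> sized m' ?w l \<and>
         (\<forall>a. a \<notin> (+) ?w ` set_tree l \<longrightarrow> m' a = m1 a)) 25 r1 m1"
    proof (rule Node.IH(1))
      show "m1 a = m0 a" if "a \<le> ?w" for a
        using m1(2) low[OF that names(2)] Node.prems(5)[OF that] by simp
      have "holds m (Suc p) (preorder l)"
        using Node.prems(11) by simp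
      then show "holds m1 (Suc p) (preorder l)"
        by (rule holds_cong) (use m1(2) high[OF _ names(2)] Node.prems(12) in simp)
    qed (use Node.prems r1 in auto)
    then show "reaches layout_program M (17 * size l + 17)
      (\<lambda>n r' m'. n = 25 \<and> r' 9 = p \<and>
         (\<forall>i. i \<notin> {9, 11, 12, 13, 14, 15} \<longrightarrow> r' i = r i) \<and> sized m' ?w ?t \<and>
         (\<forall>a. a \<notin> (+) ?w ` set_tree ?t \<longrightarrow> m' a = m a)) n1 r1 m1"
      unfolding n1
    proof (rule reaches_trans, elim conjE)
      fix n2 :: nat and r2 m2 :: "nat \<Rightarrow> nat"
      assume n2: "n2 = 25" and r2: "r2 9 = Suc p"
          "\<forall>i. i \<notin> {9, 11, 12, 13, 14, 15} \<longrightarrow> r2 i = r1 i" and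
        m2: "sized m2 ?w l" "\<forall>a. a \<notin> (+) ?w ` set_tree l \<longrightarrow> m2 a = m1 a"
      have low2: "m2 a = m0 a" if "a \<le> ?w" for a
        using m1(2) m2(2) low[OF that names(1)] low[OF that names(2)] Node.prems(5)[OF that] by simp
      \<comment> \<open>Names are distinct, so the later scan of \<open>l\<close> cannot overwrite
        the sizes stored for \<open>t'\<close>.\<close>
      have sized_t': "sized m2 ?w t'"
      proof (rule sized_cong[OF m1(1)])
        fix y assume "y \<in> set_tree t'"
        then have "?w + y \<notin> (+) ?w ` set_tree l"
          using names(5) by (auto simp del: mult_Suc_right)
        then show "m2 (?w + y) = m1 (?w + y)"
          using m2(2) by blast
      qed
      have "m2 p = x"
        using m1(2) m2(2) high[OF Node.prems(12) names(1)] high[OF Node.prems(12) names(2)] Node.prems(11)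
        by simp
      moreover have "m2 (x + x) = root_name l" "m2 (Suc (x + x)) = root_name t'"
        using Node.prems(1) low2[of "x + x"] low2[of "Suc (x + x)"] x(2) by (simp_all flip: mult_2)
      moreover have "m2 (root_name l + ?w) = size l" "m2 (root_name t' + ?w) = size t'"
        using size_root[OF m2(1)] size_root[OF sized_t'] low2[of ?w] Node.prems(6) by simp_all
      ultimately have "reaches layout_program M 17
        (\<lambda>n r' m'. n = 25 \<and> m' = m2(x + ?w := Suc (size l + size t')) \<and> r' 9 = p \<and>
           (\<forall>i. i \<notin> {9, 11, 12, 13, 14, 15} \<longrightarrow> r' i = r2 i)) 25 r2 m2"
        using r1 r2 Node.prems(4,7-9,12) x roots M(1)
        by (intro sizes_node[where a = "3 * Suc N"]) auto
      then show "reaches layout_program M 17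
        (\<lambda>n r' m'. n = 25 \<and> r' 9 = p \<and>
           (\<forall>i. i \<notin> {9, 11, 12, 13, 14, 15} \<longrightarrow> r' i = r i) \<and> sized m' ?w ?t \<and>
           (\<forall>a. a \<notin> (+) ?w ` set_tree ?t \<longrightarrow> m' a = m a)) n2 r2 m2"
        unfolding n2
      proof (rule reaches_mono, elim conjE)
        fix n3 :: nat and r3 m3 :: "nat \<Rightarrow> nat"
        assume 3: "n3 = 25" "m3 = m2(x + ?w := Suc (size l + size t'))" "r3 9 = p"
          "\<forall>i. i \<notin> {9, 11, 12, 13, 14, 15} \<longrightarrow> r3 i = r2 i"
        have "sized m3 ?w l" "sized m3 ?w t'"
          by (rule sized_cong[OF m2(1)], use 3(2) names in force)
             (rule sized_cong[OF sized_t'], use 3(2) names in force)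
        moreover have "m3 a = m a" if "a \<notin> (+) ?w ` set_tree ?t" for a
        proof -
          have "a \<notin> (+) ?w ` set_tree l" "a \<notin> (+) ?w ` set_tree t'" "a \<noteq> x + ?w"
            using that by auto
          then show ?thesis
            using m1(2) m2(2) by (simp add: 3(2))
        qed
        ultimately show "n3 = 25 \<and> r3 9 = p \<and>
           (\<forall>i. i \<notin> {9, 11, 12, 13, 14, 15} \<longrightarrow> r3 i = r i) \<and> sized m3 ?w ?t \<and>
           (\<forall>a. a \<notin> (+) ?w ` set_tree ?t \<longrightarrow> m3 a = m a)"
          using 3 r1(2) r2(2) by (simp add: add.commute)
      qed simp
    qed simp
  qed simp
qed

end

section \<open>The initial memory and the complete run\<close>

lemma store_tree_other: "a div 2 \<notin> set_tree t \<Longrightarrow> store_tree t m a = m a"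
  by (induction t arbitrary: m) auto

lemma linked_cong:
  "linked m t \<Longrightarrow> (\<And>a. a div 2 \<in> set_tree t \<Longrightarrow> m' a = m a) \<Longrightarrow> linked m' t"
  by (induction t) auto

text \<open>Cell \<open>a\<close> belongs to the node \<open>a div 2\<close>; distinct names
  therefore own disjoint pairs of cells, and later writes preserve earlier pointers.\<close>

lemma linked_store_tree: "distinct (inorder t) \<Longrightarrow> linked (store_tree t m) t"
proof (induction t arbitrary: m)
  case (Node l x r)
  define m1 where "m1 = m(2 * x := root_name l, 2 * x + 1 := root_name r)"
  define m2 where "m2 = store_tree l m1"
  have names: "x \<notin> set_tree l" "x \<notin> set_tree r" "set_tree l \<inter> set_tree r = {}"
    using Node.prems by auto
  have "linked m2 l" "linked (store_tree r m2) r"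
    using Node by (simp_all add: m2_def)
  moreover from this(1) have "linked (store_tree r m2) l"
    by (rule linked_cong) (use names in \<open>auto intro!: store_tree_other\<close>)
  moreover have "store_tree r m2 (2 * x) = m1 (2 * x)" "store_tree r m2 (2 * x + 1) = m1 (2 * x + 1)"
    using names by (simp_all add: store_tree_other m2_def)
  ultimately show ?case
    by (simp add: m1_def m2_def)
qed simp

lemma root_name_in_set_tree: "t \<noteq> Leaf \<Longrightarrow> root_name t \<in> set_tree t"
  by (cases t) auto

lemma store_tree_le:
  "(\<And>a. m a \<le> k) \<Longrightarrow> (\<And>x. x \<in> set_tree t \<Longrightarrow> x \<le> k) \<Longrightarrow> store_tree t m a \<le> k"
proof (induction t arbitrary: m a)
  case (Node l x r)
  have "root_name t \<le> k" if "t = l \<or> t = r" for t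
    using Node.prems(2) that by (cases t) auto
  with Node show ?case
    by simp
qed simp

text \<open>The phases add up to \<open>9 + (21 * N + 5) + 2 + 17 * N + 6 + (135 * N + 5) = 173 * N
  + 27\<close>, which is at most \<open>200 * N\<close> because \<open>N \<ge> 1\<close>.\<close>

lemma (in layout_machine) layout_program_reaches:
  assumes T: "fixed_topology_tree T" and N: "size T = N"
  shows "reaches layout_program M (200 * N)
    (\<lambda>n r m. n = 103 \<and> holds m (r 0) (tree_layout B [T])) 0 (reg (initial B T)) (mem (initial B T))"
proof -
  define m0 where "m0 = store_tree T (\<lambda>_. 0)"
  define x where "x = root_name T"
  have names: "T \<noteq> Leaf" "distinct (inorder T)" "set_tree T = {1..N}"
    using T N by (auto simp: fixed_topology_tree_def)
  have "N \<ge> 1"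
    using names(1) N by (cases T) auto
  have linked: "linked m0 T"
    unfolding m0_def using names(2) by (rule linked_store_tree)
  have zero: "m0 (2 * Suc N) = 0"
    unfolding m0_def by (simp add: store_tree_other names(3))
  let ?saved = "\<lambda>r. r 1 = B \<and> r 2 = x \<and> r 3 = 1 \<and> r 5 = 2 * Suc N \<and> r 6 = 3 * Suc N \<and>
     r 7 = 4 * Suc N \<and> r 8 = (5 * Suc N :: nat)"
  have "reaches layout_program M 9
     (\<lambda>n r m. n = 9 \<and> ?saved r \<and> r 9 = 3 * Suc N \<and> r 10 = Suc (5 * Suc N) \<and> m = m0(5 * Suc N := x))
     0 (reg (initial B T)) (mem (initial B T))"
    by (rule reaches_mono[OF initialize[where N = N and x = x]])
       (use M(1) N in \<open>auto simp: initial_def x_def m0_def\<close>)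
  then show ?thesis
  proof (rule reaches_trans, elim conjE)
    fix n1 :: nat and r1 m1 :: "nat \<Rightarrow> nat"
    assume n1: "n1 = 9" and m1: "m1 = m0(5 * Suc N := x)" and
      r1: "r1 1 = B" "r1 2 = x" "r1 3 = 1" "r1 5 = 2 * Suc N" "r1 6 = 3 * Suc N" "r1 7 = 4 * Suc N"
        "r1 8 = 5 * Suc N" "r1 9 = 3 * Suc N" "r1 10 = Suc (5 * Suc N)"
    have "reaches layout_program M (21 * size T + 5)
      (\<lambda>n r' m'. n = 9 \<and> r' 10 = 5 * Suc N \<and> r' 9 = 3 * Suc N + size T \<and>
         (\<forall>i. i \<notin> {9, 10, 11, 12, 13, 14, 15} \<longrightarrow> r' i = r1 i) \<and> holds m' (3 * Suc N) (preorder T) \<and>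
         (\<forall>a<5 * Suc N. \<not> (3 * Suc N \<le> a \<and> a < 3 * Suc N + size T) \<longrightarrow> m' a = m1 a)) 9 r1 m1"
      by (rule list_preorder[OF linked])
         (use r1 M(1) N names(3) in \<open>auto simp: m1 x_def\<close>)
    then show "reaches layout_program M (21 * size T + 5 + (2 + (17 * size T + (6 + (135 * size T + 5)))))
      (\<lambda>n r m. n = 103 \<and> holds m (r 0) (tree_layout B [T])) n1 r1 m1"
      unfolding n1
    proof (rule reaches_trans, elim conjE)
      fix n2 :: nat and r2 m2 :: "nat \<Rightarrow> nat"
      assume n2: "n2 = 9" and r2: "r2 10 = 5 * Suc N" "r2 9 = 3 * Suc N + size T"
          "\<forall>i. i \<notin> {9, 10, 11, 12, 13, 14, 15} \<longrightarrow> r2 i = r1 i" and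
        m2: "holds m2 (3 * Suc N) (preorder T)"
          "\<forall>a<5 * Suc N. \<not> (3 * Suc N \<le> a \<and> a < 3 * Suc N + size T) \<longrightarrow> m2 a = m1 a"
      have m2_eq: "m2 a = m0 a" if "a < 3 * Suc N" for a
        using m2(2) that by (simp add: m1)
      have saved2: "?saved r2"
        using r1 r2(3) by simp
      have "reaches layout_program M 2
         (\<lambda>n r' m'. n = 25 \<and> m' = m2 \<and> (\<forall>i. i \<noteq> 11 \<longrightarrow> r' i = r2 i)) 9 r2 m2"
        by (rule preorder_end) (use saved2 r2 in auto)
      then show "reaches layout_program M (2 + (17 * size T + (6 + (135 * size T + 5))))
        (\<lambda>n r m. n = 103 \<and> holds m (r 0) (tree_layout B [T])) n2 r2 m2"
        unfolding n2
      proof (rule reaches_trans, elim conjE)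
        fix n3 :: nat and r3 m3 :: "nat \<Rightarrow> nat"
        assume n3: "n3 = 25" "m3 = m2" and r3: "\<forall>i. i \<noteq> 11 \<longrightarrow> r3 i = r2 i"
        have saved3: "?saved r3"
          using saved2 r3 by simp
        have "reaches layout_program M (17 * size T)
          (\<lambda>n r' m'. n = 25 \<and> r' 9 = 3 * Suc N \<and>
             (\<forall>i. i \<notin> {9, 11, 12, 13, 14, 15} \<longrightarrow> r' i = r3 i) \<and> sized m' (2 * Suc N) T \<and>
             (\<forall>a. a \<notin> (+) (2 * Suc N) ` set_tree T \<longrightarrow> m' a = m2 a)) 25 r3 m2"
          by (rule compute_sizes[OF linked])
             (use saved3 r3 r2 m2 m2_eq zero names N in auto)
        then show "reaches layout_program M (17 * size T + (6 + (135 * size T + 5)))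
          (\<lambda>n r m. n = 103 \<and> holds m (r 0) (tree_layout B [T])) n3 r3 m3"
          unfolding n3
        proof (rule reaches_trans, elim conjE)
          fix n4 :: nat and r4 m4 :: "nat \<Rightarrow> nat"
          assume n4: "n4 = 25" and r4: "r4 9 = 3 * Suc N"
              "\<forall>i. i \<notin> {9, 11, 12, 13, 14, 15} \<longrightarrow> r4 i = r3 i" and
            m4: "sized m4 (2 * Suc N) T" "\<forall>a. a \<notin> (+) (2 * Suc N) ` set_tree T \<longrightarrow> m4 a = m2 a"
          have saved4: "?saved r4" "r4 10 = 5 * Suc N"
            using saved3 r4 r3 r2(1) by simp_all
          have "reaches layout_program M 6
            (\<lambda>n r' m'. n = 46 \<and> m' = m4(4 * Suc N := x) \<and> r' 16 = Suc (4 * Suc N) \<and> r' 19 = 2 \<and> r' 21 = 0 \<and>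
               (\<forall>i. i \<notin> {11, 16, 19, 21} \<longrightarrow> r' i = r4 i)) 25 r4 m4"
            by (rule sizes_end) (use saved4 r4(1) M(1) in auto)
          then show "reaches layout_program M (6 + (135 * size T + 5))
            (\<lambda>n r m. n = 103 \<and> holds m (r 0) (tree_layout B [T])) n4 r4 m4"
            unfolding n4
          proof (rule reaches_trans, elim conjE)
            fix n5 :: nat and r5 m5 :: "nat \<Rightarrow> nat"
            assume n5: "n5 = 46" and m5: "m5 = m4(4 * Suc N := x)" and
              r5: "r5 16 = Suc (4 * Suc N)" "r5 19 = 2" "r5 21 = 0"
                "\<forall>i. i \<notin> {11, 16, 19, 21} \<longrightarrow> r5 i = r4 i"
            have "m5 a = m0 a" if "a div 2 \<in> set_tree T" for a
            proof -
              have "a < 2 * Suc N"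
                using that names(3) by auto
              then have "a \<notin> (+) (2 * Suc N) ` set_tree T" "a \<noteq> 4 * Suc N" "a < 3 * Suc N"
                by auto
              then show ?thesis
                using m4(2) m2_eq[of a] by (simp add: m5)
            qed
            with linked have "linked m5 T"
              by (rule linked_cong)
            moreover have "sized m5 (2 * Suc N) T"
              using m4(1) by (rule sized_cong) (use names(3) in \<open>auto simp: m5\<close>)
            moreover have "m5 (4 * Suc N) = x"
              by (simp add: m5)
            \<comment> \<open>From here on \<open>m5\<close> itself is the reference memory, since
              the subtree sizes are now part of it.\<close>
            ultimately have "reaches layout_program M (135 * (\<Sum>t\<leftarrow>[T]. size t) + 5)
              (\<lambda>n r' m'. n = 103 \<and> r' 0 = 3 * Suc N \<and> holds m' (3 * Suc N) (tree_layout B [T]) \<and>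
                 (\<forall>a. 3 * Suc N \<le> a \<longrightarrow> a < 3 * Suc N \<longrightarrow> m' a = m5 a)) 46 r5 m5"
              using names saved4 r4(1) r5 N
              by (intro scan_groups[where ?m0.0 = m5]) (auto simp: fixed_regs_def x_def)
            then show "reaches layout_program M (135 * size T + 5)
              (\<lambda>n r m. n = 103 \<and> holds m (r 0) (tree_layout B [T])) n5 r5 m5"
              unfolding n5 by (rule reaches_mono) auto
          qed simp
        qed simp
      qed simp
    qed simp
  qed (use N \<open>N \<ge> 1\<close> in simp)
qed

text \<open>\<open>computes\<close> inspects the machine after exactly \<open>t\<close> steps,
  whereas \<open>reaches\<close> only yields some halting time within the bound; this lemma closes
  the gap.\<close>

lemma run_halted:
  assumes "t \<le> u" "halted P (run P t s)"
  shows "run P u s = run P t s"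
  using assms
proof (induction u rule: dec_induct)
  case (step u)
  then show ?case
    using run_add[of P u 1 s] by (simp add: run_Suc step_def)
qed simp

lemma length_tree_layout: "length (tree_layout B [T]) = size T"
  using arg_cong[OF mset_tree_layout_single[of B T], of size] by simp

lemma layout_program_computes:
  assumes "B \<ge> 1" and T: "fixed_topology_tree T"
  shows "computes layout_program B T (200 * size T) ((size T + B) ^ 6) (tree_layout B [T])"
proof -
  define N where "N = size T"
  define S where "S = N + B"
  have names: "T \<noteq> Leaf" "set_tree T = {1..N}"
    using T by (auto simp: fixed_topology_tree_def N_def)
  then have "N \<ge> 1"
    unfolding N_def by (cases T) auto
  then have "S \<ge> 2" "N \<le> S" "B \<le> S"
    using \<open>B \<ge> 1\<close> by (auto simp: S_def)
  \<comment> \<open>The exponent 6 absorbs additive constants: \<open>S \<ge> 2\<close> gives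
    \<open>S ^ 6 \<ge> 32 * S \<ge> 8 * N + 20\<close>, while the products need only
    \<open>S ^ 3\<close>.\<close>
  have "2 ^ 5 \<le> S ^ 5"
    using \<open>S \<ge> 2\<close> by (intro power_mono) auto
  then have "2 ^ 5 * S \<le> S ^ 6"
    using mult_le_mono1[of "2 ^ 5" "S ^ 5" S] by (simp add: eval_nat_numeral mult_ac)
  then have linear: "8 * N + 20 \<le> S ^ 6" "S \<le> S ^ 6"
    using \<open>N \<le> S\<close> \<open>N \<ge> 1\<close> \<open>B \<ge> 1\<close> by (simp_all add: S_def)
  have cubic: "y * N\<^sup>2 \<le> S ^ 6" if "y \<le> S" for y
  proof -
    have "y * N\<^sup>2 \<le> S * S\<^sup>2"
      using that \<open>N \<le> S\<close> by (intro mult_le_mono power_mono) auto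
    also have "\<dots> = S ^ 3"
      by (simp add: power2_eq_square power3_eq_cube)
    also have "\<dots> \<le> S ^ 6"
      using \<open>S \<ge> 2\<close> by (intro power_increasing) auto
    finally show ?thesis .
  qed
  interpret layout_machine N B "S ^ 6"
    using \<open>B \<ge> 1\<close> linear cubic \<open>N \<le> S\<close> \<open>B \<le> S\<close> by unfold_locales auto
  let ?s = "initial B T"
  have start: "\<lparr>pc = 0, reg = reg ?s, mem = mem ?s\<rparr> = ?s"
    by (simp add: initial_def)
  have "root_name T \<le> N"
    using names root_name_in_set_tree[of T] by auto
  moreover have "store_tree T (\<lambda>_. 0) a \<le> N" for a
    using names by (intro store_tree_le) auto
  moreover have "N \<le> S ^ 6" "B \<le> S ^ 6"
    using linear(2) \<open>N \<le> S\<close> \<open>B \<le> S\<close> by simp_all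
  ultimately have "root_name T \<le> S ^ 6" "store_tree T (\<lambda>_. 0) a \<le> S ^ 6" for a
    by (blast intro: order_trans)+
  with \<open>N \<le> S ^ 6\<close> \<open>B \<le> S ^ 6\<close> have "word_bounded (S ^ 6) ?s"
    by (simp add: word_bounded_def initial_def N_def)
  then obtain t n r m where t: "t \<le> 200 * N"
    "\<And>i. i \<le> t \<Longrightarrow> word_bounded (S ^ 6) (run layout_program i ?s)"
    "run layout_program t ?s = \<lparr>pc = n, reg = r, mem = m\<rparr>" "n = 103"
    "holds m (r 0) (tree_layout B [T])"
    using layout_program_reaches[OF T N_def[symmetric]] unfolding reaches_def start by blast
  have halted: "halted layout_program (run layout_program t ?s)"
    by (simp add: t(3,4) halted_def)
  note final = run_halted[OF _ halted]
  have "word_bounded (S ^ 6) (run layout_program i ?s)" for i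
    using t(2)[of i] t(2)[of t] final[of i] by (cases "i \<le> t") auto
  moreover have "tree_layout B [T] = output_array N (run layout_program t ?s)"
    using t(5) length_tree_layout[of B T]
    by (intro nth_equalityI) (auto simp: output_array_def t(3) holds_def N_def)
  ultimately show ?thesis
    using halted final[OF t(1)] by (simp add: computes_def N_def S_def)
qed

text \<open>\<open>layout\<close> is chosen before \<open>\<alpha>\<close> and
  \<open>\<beta>\<close>, so a single layout serves all readings of the regime boundaries.
  \<open>max 1\<close> is there because a path of length 0 already costs one transfer while
  \<open>D / log 2 (1 + b)\<close> is 0.\<close>

theorem theorem1:
  "\<exists>(P :: instr list) (c :: nat) (k :: nat) (layout :: nat \<Rightarrow> nat tree \<Rightarrow> nat list).
     (\<forall>B T. B \<ge> 1 \<longrightarrow> fixed_topology_tree T \<longrightarrow>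
        computes P B T (c * size T) ((size T + B) ^ k) (layout B T) \<and>
        is_layout T (layout B T)) \<and>
     (\<forall>(\<alpha>::real) (\<beta>::real). \<alpha> > 0 \<longrightarrow> \<beta> > 0 \<longrightarrow>
        (\<exists>C::real. C > 0 \<and>
          (\<forall>B T p. B \<ge> 1 \<longrightarrow> fixed_topology_tree T \<longrightarrow> root_path T p \<longrightarrow>
             (let D = real (path_length p);
                  lgN = log 2 (real (size T));
                  b = real B;
                  transfers = real (memory_transfers B (layout B T) p)
              in (D \<le> \<alpha> * lgN \<longrightarrow>
                    transfers \<le> C * max 1 (D / log 2 (1 + b))) \<and>
                 (\<alpha> * lgN \<le> D \<and> D \<le> \<beta> * (b * lgN) \<longrightarrow>
                    transfers \<le> C * max 1 (lgN / log 2 (1 + b * lgN / D))) \<and>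
                 (\<beta> * (b * lgN) \<le> D \<longrightarrow>
                    transfers \<le> C * max 1 (D / b))))))"
proof -
  have "computes layout_program B T (200 * size T) ((size T + B) ^ 6) (tree_layout B [T]) \<and>
      is_layout T (tree_layout B [T])" if "B \<ge> 1" "fixed_topology_tree T" for B T
    using that layout_program_computes[of B T]
    by (simp add: is_layout_def fixed_topology_tree_def distinct_tree_layout set_tree_layout)
  moreover have "\<exists>C::real. C > 0 \<and>
      (\<forall>B T p. B \<ge> 1 \<longrightarrow> fixed_topology_tree T \<longrightarrow> root_path T p \<longrightarrow>
         (let D = real (path_length p);
              lgN = log 2 (real (size T));
              b = real B;
              transfers = real (memory_transfers B (tree_layout B [T]) p)
          in (D \<le> \<alpha> * lgN \<longrightarrow>
                transfers \<le> C * max 1 (D / log 2 (1 + b))) \<and>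
             (\<alpha> * lgN \<le> D \<and> D \<le> \<beta> * (b * lgN) \<longrightarrow>
                transfers \<le> C * max 1 (lgN / log 2 (1 + b * lgN / D))) \<and>
             (\<beta> * (b * lgN) \<le> D \<longrightarrow>
                transfers \<le> C * max 1 (D / b))))" (is "\<exists>C. C > 0 \<and> ?bounds C")
    if "\<beta> > 0" for \<alpha> \<beta> :: real
  proof -
    define C where "C = 10 * (1 + (2 + \<beta>) * max 1 (ln (1 + 1 / \<beta>)) / ln 2 + 2 / \<beta>)"
    have "(2 + \<beta>) * max 1 (ln (1 + 1 / \<beta>)) / ln 2 \<ge> 0" "2 / \<beta> \<ge> 0"
      using that by auto
    then have "C > 0"
      unfolding C_def by (intro mult_pos_pos add_pos_nonneg) simp_all
    moreover have "?bounds C"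
      unfolding Let_def C_def fixed_topology_tree_def
      using tree_layout_transfers[OF that, unfolded Let_def] by blast
    ultimately show ?thesis
      by blast
  qed
  ultimately show ?thesis
    by (intro exI[of _ layout_program] exI[of _ 200] exI[of _ 6]
        exI[of _ "\<lambda>B T. tree_layout B [T]"]) blast
qed

end
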